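(* For every rational number $\frac pq\in\left[\frac12,\frac23\right]$ with $2\le q\le 18$ there is a neighbourhood $U\subset(0,1)$ of $\frac pq$ such that $L(x)<\infty$ for every $x\in U$ (i.e. the M&m sequence of $x$ is eventually constant) and the function $x\mapsto m(x)$ is continuous on $U$. Moreover, $m$ is given by the following explicit formulas. Near $\frac12$: $$m(x)=\begin{cases} \frac{333}{8}x-\frac{325}{16},&\frac{1}{2}\leq x\leq \frac{2911001}{5684610}\\ -\frac{2840973}{32}x+\frac{2909701}{64},&\frac{2911001}{5684610}\leq x\leq \frac{339}{662}\\ \frac{2842297}{32}x-\frac{2910929}{64},&\frac{339}{662}\leq x\leq \frac{2909629}{5681930}\\ \frac{333}{8}x-\frac{325}{16},&\frac{2909629}{5681930}\leq x\leq \frac{90028408624696264845}{175783207694477729162}\\ -\frac{87891603847238182597}{16384}x+\frac{90028408624695599245}{32768},&\frac{90028408624696264845}{175783207694477729162}\leq x\leq \frac{120193266020529}{234681009773714}\\ \frac{87885645878322471973}{16384}x-\frac{90022305806717048045}{32768},&\frac{120193266020529}{234681009773714}\leq x \leq \frac{90022305806716382445}{175771291756643579978}. \end{cases}$$ Near $\frac23$: $$m(x)=\begin{cases} -\frac{75675009}{256}x+\frac{25065033}{128},&\frac{50110610}{75646209}\leq x\leq \frac{626}{945}\\ \frac{75647841}{256}x-\frac{25055657}{128},&\frac{626}{945}\leq x\leq \frac{50130770}{75676641}\\ -\frac{225}{2}x+76,&\frac{50130770}{75676641}\leq x\leq \frac{2}{3}. \end{cases}$$ Near the other rational points: Near $\frac35$: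 $m(x)=-\frac{126466131}{256}x+\frac{75880293}{256}$ for $\frac{76675523}{127792541}\leq x\leq \frac{3}{5}$, and $m(x)=\frac{126310099}{256}x-\frac{75785445}{256}$ for $\frac{3}{5}\leq x\leq \frac{4194392}{6990653}$. Near $\frac47$: $m(x)=-\frac{200985}{16}x+\frac{14359}{2}$ for $\frac{1954924}{3421219}\leq x\leq \frac{4}{7}$, and $m(x)=\frac{202033}{16}x-7214$ for $\frac{4}{7}\leq x\leq \frac{44485228}{77846827}$. Near $\frac58$: $m(x)=-\frac{71307}{4}x+\frac{356603}{32}$ for $\frac{80040341}{128065272}\leq x\leq \frac{5}{8}$, and $m(x)=\frac{71307}{4}x-\frac{356467}{32}$ for $\frac{5}{8}\leq x\leq \frac{149898117}{239835656}$. Near $\frac59$: $m(x)=\frac{3}{16}(24185-43521x)$ for $\frac{24959983}{44928379}\leq x\leq \frac{5}{9}$, and $m(x)=\frac{9}{16}(14467x-8035)$ for $\frac{5}{9}\leq x\leq \frac{20203}{36365}$. Near $\frac6{11}$: $m(x)=-\frac{139480363}{2048}x+\frac{38041891}{1024}$ for $\frac{2034476}{3729873}\leq x\leq \frac{6}{11}$, and $m(x)=\frac{139446571}{2048}x-\frac{38029091}{1024}$ for $\frac{6}{11}\leq x\leq \frac{2002180}{3670663}$. Near $\frac7{11}$: $m(x)=-\frac{49767}{16}x+\frac{31691}{16}$ for $\frac{161123}{253207}\leq x\leq \frac{7}{11}$, and $m(x)=\frac{49695}{16}x-\frac{31603}{16}$ for $\frac{7}{11}\leq x\leq \frac{1100921}{1729909}$.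 Near $\frac7{12}$: $m(x)=-213x+\frac{501}{4}$ for $\frac{7381379}{12670284}\leq x\leq \frac{7}{12}$, and $m(x)=219x-\frac{507}{4}$ for $\frac{7}{12}\leq x\leq \frac{52083521}{89164436}$. Near $\frac7{13}$: $m(x)=-\frac{424918635}{32}x+\frac{228802391}{32}$ for $\frac{339327836}{630180267}\leq x\leq \frac{7}{13}$, and $m(x)=\frac{424847139}{32}x-\frac{228763795}{32}$ for $\frac{7}{13}\leq x\leq \frac{4675837673}{8683698531}$. Near $\frac8{13}$: $m(x)=-\frac{9504682471614359}{1024}x+\frac{731129420893811}{128}$ for $\frac{411836560641067}{669234411041734}\leq x\leq \frac{8}{13}$, and $m(x)=\frac{9504493870368247}{1024}x-\frac{731114913104851}{128}$ for $\frac{8}{13}\leq x\leq \frac{1656012165640316}{2691019769165513}$. Near $\frac9{14}$: $m(x)=-\frac{313309}{32}x+\frac{402931}{64}$ for $\frac{345573}{537562}\leq x\leq \frac{9}{14}$, and $m(x)=\frac{312701}{32}x-\frac{401939}{64}$ for $\frac{9}{14}\leq x\leq \frac{83961}{130604}$. Near $\frac8{15}$: $m(x)=-\frac{19695}{8}x+1314$ for $\frac{15838}{29697}\leq x\leq \frac{8}{15}$, and $m(x)=\frac{19815}{8}x-1320$ for $\frac{8}{15}\leq x\leq \frac{27100}{50811}$. Near $\frac9{16}$: $m(x)=-486x+\frac{2195}{8}$ for $\frac{599428}{1066971}\leq x\leq \frac{9}{16}$, and $m(x)=494x-\frac{2215}{8}$ for $\frac{9}{16}\leq x\leq \frac{340224257}{604065151}$.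 Near $\frac9{17}$: $m(x)=-\frac{151759}{32}x+\frac{80375}{32}$ for $\frac{50463303}{95323759}\leq x\leq \frac{9}{17}$, and $m(x)=\frac{152303}{32}x-\frac{80599}{32}$ for $\frac{9}{17}\leq x\leq \frac{82731}{156263}$. Near $\frac{10}{17}$: $m(x)=-\frac{11203293}{2}x+3295088$ for $\frac{40009991}{68016985}\leq x\leq \frac{10}{17}$, and $m(x)=\frac{11211513}{2}x-3297502$ for $\frac{10}{17}\leq x\leq \frac{8901073}{15131824}$. Near $\frac{11}{17}$: $m(x)=-\frac{11184345087}{1024}x+\frac{7236931237}{1024}$ for $\frac{193668583}{299305992}\leq x\leq \frac{11}{17}$, and $m(x)=\frac{11198078463}{1024}x-\frac{7245813413}{1024}$ for $\frac{11}{17}\leq x\leq \frac{190590017}{294548208}$. Near $\frac{11}{18}$: $m(x)=-\frac{361818645}{128}x+\frac{442223279}{256}$ for $\frac{362832747}{593726330}\leq x\leq \frac{11}{18}$, and $m(x)=\frac{361521237}{128}x-\frac{441858799}{256}$ for $\frac{11}{18}\leq x\leq \frac{71738975}{117391047}$.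
   Context: The median of a finite list of real numbers $\xi_1,\dots,\xi_N$ with increasing rearrangement $\xi_{i_1}\le\dots\le\xi_{i_N}$ is $\mathrm{med}(\xi_1,\dots,\xi_N)=\xi_{i_{(N+1)/2}}$ if $N$ is odd and $\frac12(\xi_{i_{N/2}}+\xi_{i_{N/2+1}})$ if $N$ is even (repetitions counted with multiplicity). For $0<x<1$, put $x_1=0$, $x_2=x$, $x_3=1$, and for $n\ge4$ let $x_n$ be the unique real number such that $$\frac{x_1+x_2+\dots+x_n}{n}=\mathrm{med}(x_1,\dots,x_{n-1}).$$ The sequence $(x_4,x_5,\dots)$ is the M&m sequence of $x$. Put $m_n=\mathrm{med}(x_1,\dots,x_n)$ for $n\ge4$; the sequence $(m_n)_{n\ge 4}$ is known to be monotone. The length $L(x)$ is the minimum integer $k$ such that $x_n=x_k$ for all $n>k$, with $L(x)=\infty$ if no such $k$ exists. The mean-median map is $m(x)=\lim_{n\to\infty}m_n$, provided this (finite) limit exists; when $L(x)<\infty$, the sequence of medians is eventually constant and $m(x)$ is its eventual value. *)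

theory Defs
  imports "HOL-Analysis.Analysis" "HOL-Library.Extended_Nat"
begin

definition med :: "real list \<Rightarrow> real" where
  "med xs =
    (let ys = sort xs; N = length xs in
     if odd N then ys ! ((N + 1) div 2 - 1)
     else (ys ! (N div 2 - 1) + ys ! (N div 2)) / 2)"

text \<open>The sequence is indexed from 1; the value at index 0 is a dummy and is never used.\<close>

function mm_seq :: "real \<Rightarrow> nat \<Rightarrow> real" where
  "mm_seq x n =
    (if n \<le> 1 then 0 else if n = 2 then x else if n = 3 then 1
     else (THE y. (sum_list (map (mm_seq x) [1..<n]) + y) / real n = med (map (mm_seq x) [1..<n])))"
  by pat_completeness auto
termination
  by (relation "Wellfounded.measure snd") auto

declare mm_seq.simps [simp del]

definition mm_median :: "real \<Rightarrow> nat \<Rightarrow> real" where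
  "mm_median x n = med (map (mm_seq x) [1..<Suc n])"

text \<open>The infimum of the empty set in \<^typ>\<open>enat\<close> is \<open>\<infinity>\<close>, which covers the
  case where the sequence never stabilizes.\<close>

definition mm_length :: "real \<Rightarrow> enat" where
  "mm_length x = Inf {enat k | k. 1 \<le> k \<and> (\<forall>n>k. mm_seq x n = mm_seq x k)}"

definition mm_map :: "real \<Rightarrow> real" where
  "mm_map x = lim (mm_median x)"

text \<open>Since \<^const>\<open>lim\<close> is total, existence of the limit is asserted separately
  from its value.\<close>

definition mm_map_given_on :: "real set \<Rightarrow> (real \<Rightarrow> real) \<Rightarrow> bool" where
  "mm_map_given_on A f \<longleftrightarrow> (\<forall>x\<in>A. convergent (mm_median x) \<and> mm_map x = f x)"

text \<open>The definite description in \<^const>\<open>mm_seq\<close> is well defined.\<close>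

lemma mm_next_iff:
  assumes "n \<ge> 4"
  shows "(S + y) / real n = M \<longleftrightarrow> y = real n * M - S"
  using assms by (auto simp: field_simps)

lemma mm_seq_mean:
  assumes "n \<ge> 4"
  shows "(\<Sum>i=1..n. mm_seq x i) / real n = mm_median x (n - 1)"
proof -
  let ?xs = "map (mm_seq x) [1..<n]"
  have "mm_seq x n = (THE y. (sum_list ?xs + y) / real n = med ?xs)"
    using assms by (subst mm_seq.simps) auto
  also have "\<dots> = real n * med ?xs - sum_list ?xs"
    unfolding mm_next_iff[OF assms] by simp
  finally have *: "sum_list ?xs + mm_seq x n = real n * med ?xs" by simp
  have "(\<Sum>i=1..n. mm_seq x i) = sum_list (map (mm_seq x) [1..<Suc n])"
    by (simp only: sum_set_upt_conv_sum_list_nat[symmetric] atLeastLessThanSuc_atLeastAtMost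
        atLeastLessThan_upt[symmetric])
  also have "\<dots> = sum_list ?xs + mm_seq x n"
    using assms by simp
  finally show ?thesis using * assms by (simp add: mm_median_def)
qed

end

theory Submission
  imports Defs
begin

text \<open>
  The medians form a monotone sequence; for \<open>x \<ge> 1/2\<close> it increases. Hence only the terms above the
  current median matter, and as soon as the median reaches a value which occurs twice among them,
  it stays there for ever. Near a given point \<open>p/q\<close> the terms are affine functions of \<open>x\<close> as long as no two
  relevant ones cross, so a whole interval can be followed by one computation with pairs of
  integers, comparing affine functions through their values at the ends. Terms above the
  prospective final median never become a median and are dropped. Where two formulas for the final
  median are adjacent, the smaller of the two is reached first, so that a single run yields
  the minimum of the two. The points to the left of \<open>1/2\<close> follow from the symmetry \<open>x \<mapsto> 1 - x\<close>.
\<close>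

section \<open>Medians and their dynamics\<close>

text \<open>Settling at \<open>p / q\<close> itself is not enough. At \<open>1 / 2\<close> the
  fourth term already equals the median and the sequence is constant from there on; for
  \<open>t > 0\<close> the terms with equal constant coefficient are told apart by their slopes, and
  these go on changing through many more steps. Stability on an interval requires two terms that
  coincide as affine functions, which is why equality with a threshold is tested on coefficients: a
  tie at the single point \<open>t = 0\<close> says nothing about its neighbours. The obstacle is
  that terms may cross inside the interval. Crossings above the final median are harmless; those
  below it limit how far one run can reach. To tell the two apart the final formula must be supplied
  in advance. It enters as an untrusted guess, which the run confirms by having met each threshold
  twice when no other term is left.\<close>

lemma med_mset_cong: "mset xs = mset ys \<Longrightarrow> med xs = med ys"
  unfolding med_def using mset_eq_length properties_for_sort_key sorted_list_of_multiset_mset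
  by (metis (no_types))

lemma sorted_split:
  fixes c :: "'a :: linorder"
  assumes "\<forall>l\<in>#L. l \<le> c" "\<forall>y\<in>#X. c \<le> y"
  shows "sorted (sorted_list_of_multiset L @ c # sorted_list_of_multiset X)"
  using assms by (fastforce simp: sorted_append)

lemma sort_split:
  fixes c :: "'a :: linorder"
  assumes "mset xs = L + {#c#} + X" "\<forall>l\<in>#L. l \<le> c" "\<forall>y\<in>#X. c \<le> y"
  shows "sort xs = sorted_list_of_multiset L @ c # sorted_list_of_multiset X"
  by (rule properties_for_sort) (use assms in \<open>simp_all add: sorted_split\<close>)

lemma size_sorted_list_of_multiset [simp]: "length (sorted_list_of_multiset M) = size M"
  by (metis mset_sorted_list_of_multiset size_mset)

lemma med_odd:
  assumes "mset xs = L + {#c#} + X" "\<forall>l\<in>#L. l \<le> c" "\<forall>y\<in>#X. c \<le> y" "size L = size X"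
  shows "med xs = c"
proof -
  have "length xs = 2 * size L + 1"
    using arg_cong[OF assms(1), of size] assms(4) by simp
  thus ?thesis
    using sort_split[OF assms(1-3)] by (simp add: med_def Let_def nth_append)
qed

lemma med_even:
  assumes "mset xs = L + {#c#} + X" "\<forall>l\<in>#L. l \<le> c" "\<forall>y\<in>#X. c \<le> y" "size X = size L + 1"
    and "r \<in># X" "\<forall>y\<in>#X. r \<le> y"
  shows "med xs = (c + r) / 2"
proof -
  have len: "length xs = 2 * (size L + 1)"
    using arg_cong[OF assms(1), of size] assms(4) by simp
  obtain Y where X: "X = add_mset r Y" using assms(5) by (metis insert_DiffM)
  let ?ys = "r # sorted_list_of_multiset Y"
  have "sorted ?ys" "mset ?ys = X"
    using assms(6) by (simp_all add: X)
  hence s: "sorted_list_of_multiset X = ?ys"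
    by (metis sorted_list_of_multiset_mset sort_key_id_if_sorted map_ident)
  show ?thesis
    using sort_split[OF assms(1-3)] len by (simp add: med_def Let_def nth_append s)
qed

lemma med_affine:
  "med (map (\<lambda>y. a * y + b) xs) = a * med xs + b" if "xs \<noteq> []" for a b :: real
proof -
  let ?f = "\<lambda>y. a * y + b" and ?N = "length xs"
  have N: "?N > 0" using that by simp
  have less: "?N div 2 < ?N" "?N div 2 - 1 < ?N" "(?N + 1) div 2 - 1 < ?N"
    using N by presburger+
  have sorted: "sorted (sort xs)" by simp
  show ?thesis
  proof (cases "a \<ge> 0")
    case True
    have "sort (map ?f xs) = map ?f (sort xs)"
      by (rule properties_for_sort)
        (use sorted True in \<open>auto simp: sorted_wrt_map intro!: sorted_wrt_mono_rel[OF _ sorted] mult_left_mono\<close>)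
    thus ?thesis using less
      by (simp add: med_def Let_def add_divide_distrib algebra_simps)
  next
    case False
    \<comment> \<open>A negative factor reverses the sorted list; reversal fixes the middle index
      for odd length and swaps the two middle indices for even length.\<close>
    have "sort (map ?f xs) = rev (map ?f (sort xs))"
      by (rule properties_for_sort)
        (use sorted False in \<open>auto simp: sorted_wrt_rev sorted_wrt_map intro!: sorted_wrt_mono_rel[OF _ sorted] mult_left_mono_neg\<close>)
    moreover have "?N - Suc (?N div 2) = ?N div 2" "?N - Suc ((?N + 1) div 2 - 1) = (?N + 1) div 2 - 1" if "odd ?N"
      using that by presburger+
    moreover have "?N - Suc (?N div 2 - 1) = ?N div 2" "?N - Suc (?N div 2) = ?N div 2 - 1" if "even ?N"
      using that N by presburger+
    ultimately show ?thesis using less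
      by (auto simp: med_def Let_def rev_nth add_divide_distrib algebra_simps)
  qed
qed

text \<open>The mean equation without initial values is inherited by all
  \<open>a * mm_seq x n + b\<close>, which covers both the scaling to integer coefficients and the
  reflection at \<open>1 / 2\<close>.\<close>

definition mm_like :: "(nat \<Rightarrow> real) \<Rightarrow> bool" where
  "mm_like w \<longleftrightarrow> (\<forall>n\<ge>4. (\<Sum>i=1..n. w i) = real n * med (map w [1..<n]))"

lemma mm_like_next:
  assumes "mm_like w" "n \<ge> 4"
  shows "w (Suc n) = real (Suc n) * med (map w [1..<Suc n]) - real n * med (map w [1..<n])"
proof -
  have "(\<Sum>i=1..Suc n. w i) = real (Suc n) * med (map w [1..<Suc n])"
    using assms(1,2) unfolding mm_like_def by (metis le_SucI)
  moreover have "(\<Sum>i=1..n. w i) = real n * med (map w [1..<n])"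
    using assms unfolding mm_like_def by simp
  ultimately show ?thesis by (simp add: sum.atLeast_Suc_atMost)
qed

text \<open>At odd times the median \<open>c\<close> is a term of the sequence; \<open>X\<close> collects the terms above it, the
  next term \<open>w (n + 1)\<close> being included already.\<close>

definition upper_part :: "(nat \<Rightarrow> real) \<Rightarrow> nat \<Rightarrow> real \<Rightarrow> real multiset \<Rightarrow> bool" where
  "upper_part w n c X \<longleftrightarrow> odd n \<and> 3 \<le> n \<and> med (map w [1..<Suc n]) = c \<and> 2 * size X = n + 1 \<and>
     (\<forall>y\<in>#X. c \<le> y) \<and>
     (\<exists>L. mset (map w [1..<Suc (Suc n)]) = L + {#c#} + X \<and> (\<forall>l\<in>#L. l \<le> c))"

lemma upper_part_med:
  assumes "upper_part w n c X" "r \<in># X" "\<forall>y\<in>#X. r \<le> y"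
  shows "med (map w [1..<Suc (Suc n)]) = (c + r) / 2"
proof -
  obtain L where L: "mset (map w [1..<Suc (Suc n)]) = L + {#c#} + X" "\<forall>l\<in>#L. l \<le> c"
    and X: "\<forall>y\<in>#X. c \<le> y" "2 * size X = n + 1"
    using assms(1) unfolding upper_part_def by blast
  have "size (mset (map w [1..<Suc (Suc n)])) = n + 1" by simp
  hence "size X = size L + 1" using X(2) unfolding L(1) by simp
  thus ?thesis using med_even[OF L X(1)] assms(2,3) by blast
qed

lemma upper_part_step:
  assumes w: "mm_like w" and up: "upper_part w n c X" and r: "r \<in># X" "\<forall>y\<in>#X. r \<le> y"
    and p: "p = real (n + 2) * ((r - c) / 2)"
  shows "w (n + 2) = c + p" "w (n + 3) = r + p"
    "upper_part w (n + 2) r (X - {#r#} + {#c + p, r + p#})"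
proof -
  obtain L where L: "mset (map w [1..<Suc (Suc n)]) = L + {#c#} + X" "\<forall>l\<in>#L. l \<le> c"
    and n: "odd n" "3 \<le> n" and c: "med (map w [1..<Suc n]) = c"
    and X: "\<forall>y\<in>#X. c \<le> y" "2 * size X = n + 1"
    using up unfolding upper_part_def by blast
  obtain Y where Y: "X = add_mset r Y" using r(1) by (metis insert_DiffM)
  have cr: "c \<le> r" using X(1) r(1) by blast
  have med1: "med (map w [1..<Suc (Suc n)]) = (c + r) / 2"
    by (rule upper_part_med[OF up r])
  show w2: "w (n + 2) = c + p"
    using mm_like_next[OF w, of "Suc n", unfolded med1 c] n(2) by (simp add: p field_simps)
  \<comment> \<open>Since \<open>c + p - r = n * (r - c) / 2\<close>, both new terms land at or
    above \<open>r\<close>, so the lower part never matters again.\<close>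
  have "0 \<le> real n * (r - c)" using cr by simp
  hence rp: "r \<le> c + p" "r \<le> r + p" using cr by (simp_all add: p field_simps)
  have sz: "size L + size X = n"
    using arg_cong[OF L(1), of size] by (simp del: upt_Suc)
  have ms: "mset (map w [1..<Suc (Suc (Suc n))]) = (L + {#c#}) + {#r#} + add_mset (c + p) Y"
    using L(1) w2 by (simp add: Y)
  have med2: "med (map w [1..<Suc (Suc (Suc n))]) = r"
    by (rule med_odd[OF ms]) (use L(2) cr r(2) rp X(2) sz in \<open>auto simp: Y\<close>)
  show w3: "w (n + 3) = r + p"
    using mm_like_next[OF w, of "Suc (Suc n)", unfolded med1 med2] n(2)
    by (simp add: p numeral_3_eq_3 field_simps)
  have "mset (map w [1..<Suc (Suc (n + 2))]) = (L + {#c#}) + {#r#} + (X - {#r#} + {#c + p, r + p#})"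
    using ms w3 n(2) by (simp add: Y numeral_3_eq_3 add_mset_commute)
  moreover have "\<forall>l\<in>#L + {#c#}. l \<le> r" using L(2) cr by auto
  ultimately show "upper_part w (n + 2) r (X - {#r#} + {#c + p, r + p#})"
    unfolding upper_part_def using n med2 X(2) r(2) rp by (auto simp: Y)
qed

definition stabilizes :: "(nat \<Rightarrow> real) \<Rightarrow> real \<Rightarrow> bool" where
  "stabilizes w v \<longleftrightarrow> (\<exists>N\<ge>1. \<forall>n\<ge>N. w n = v \<and> med (map w [1..<Suc n]) = v)"

text \<open>With \<open>r = c = v\<close> the increment \<open>p\<close> vanishes, so a step takes
  one copy of \<open>v\<close> out of \<open>X\<close> and puts two back.\<close>

lemma upper_part_stabilizes_same:
  assumes w: "mm_like w" and up: "upper_part w n v X" and v: "v \<in># X"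
  shows "stabilizes w v"
proof -
  have *: "\<exists>Y. upper_part w (n + 2 * j) v Y \<and> v \<in># Y" for j
  proof (induction j)
    case 0
    thus ?case using up v by auto
  next
    case (Suc j)
    then obtain Y where Y: "upper_part w (n + 2 * j) v Y" "v \<in># Y" by blast
    hence "\<forall>y\<in>#Y. v \<le> y" unfolding upper_part_def by blast
    from upper_part_step(3)[OF w Y this refl] show ?case by auto
  qed
  have "w m = v \<and> med (map w [1..<Suc m]) = v" if "m \<ge> n + 2" for m
  proof -
    define j where "j = (m - n - 2) div 2"
    obtain Y where Y: "upper_part w (n + 2 * j) v Y" "v \<in># Y" using * by blast
    hence ge: "\<forall>y\<in>#Y. v \<le> y" unfolding upper_part_def by blast
    note step = upper_part_step[OF w Y ge refl]
    have med: "med (map w [1..<Suc (Suc (n + 2 * j + 2))]) = v"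
      using upper_part_med[OF step(3), of v] step(3) unfolding upper_part_def by auto
    have med': "med (map w [1..<Suc (n + 2 * j + 2)]) = v"
      using step(3) unfolding upper_part_def by blast
    have "m = n + 2 * j + 2 \<or> m = n + 2 * j + 3"
      using that unfolding j_def by presburger
    thus ?thesis using step(1,2) med med' by (auto simp: numeral_3_eq_3)
  qed
  moreover have "1 \<le> n + 2" by simp
  ultimately show ?thesis unfolding stabilizes_def by blast
qed

lemma upper_part_stabilizes:
  assumes w: "mm_like w" and up: "upper_part w n c X" and v: "count X v \<ge> 2" "\<forall>y\<in>#X. v \<le> y"
  shows "stabilizes w v"
proof -
  have v1: "v \<in># X" "v \<in># X - {#v#}"
    using v(1) by (simp_all flip: count_greater_zero_iff)
  from upper_part_step(3)[OF w up v1(1) v(2) refl] upper_part_stabilizes_same[OF w] v1(2)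
  show ?thesis by auto
qed

section \<open>Following the sequence over an interval\<close>

text \<open>Over a short interval every term of the sequence is an affine function
  \<open>u + v * t\<close> with integers \<open>u\<close>, \<open>v\<close>, after rescaling and a change of coordinates.\<close>

type_synonym aff = "int \<times> int"
type_synonym thresholds = "(aff \<times> nat) list"
type_synonym state = "int \<times> aff \<times> aff list \<times> thresholds"

definition value_at :: "real \<Rightarrow> aff \<Rightarrow> real" where
  "value_at t a = of_int (fst a) + of_int (snd a) * t"

text \<open>Sufficient for \<open>a \<ge> b\<close> on the whole range \<open>0 \<le> t \<le> P / Q\<close>. Equal constant terms, by far the
  most frequent case in long runs, are decided without a multiplication.\<close>

fun geq :: "int \<Rightarrow> int \<Rightarrow> aff \<Rightarrow> aff \<Rightarrow> bool" where
  "geq P Q (u, v) (u', v') =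
     (if u = u' then v' \<le> v
      else if u' < u then (if v' \<le> v then True else (v' - v) * P \<le> (u - u') * Q)
      else False)"

fun cons_option :: "'a \<Rightarrow> 'a list option \<Rightarrow> 'a list option" where
  "cons_option x None = None"
| "cons_option x (Some xs) = Some (x # xs)"

text \<open>\<open>None\<close> means that neither order could be certified on the whole range of
  \<open>t\<close>; it aborts the run.\<close>

fun insert_sorted :: "int \<Rightarrow> int \<Rightarrow> aff \<Rightarrow> aff list \<Rightarrow> aff list option" where
  "insert_sorted P Q a [] = Some [a]"
| "insert_sorted P Q a (r # rs) =
     (if geq P Q a r then cons_option r (insert_sorted P Q a rs)
      else if geq P Q r a then Some (a # r # rs) else None)"

text \<open>Terms above one of the thresholds, the candidates for the final median, are only counted,
  and only if they are equal to the threshold.\<close>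

fun discard :: "int \<Rightarrow> int \<Rightarrow> aff \<Rightarrow> thresholds \<Rightarrow> thresholds option" where
  "discard P Q a [] = None"
| "discard P Q a ((d, k) # ds) =
     (if a = d then Some ((d, Suc k) # ds)
      else if geq P Q a d then Some ((d, k) # ds)
      else cons_option (d, k) (discard P Q a ds))"

text \<open>Thresholds are consulted first, so a discarded term is never compared with the retained
  ones.\<close>

fun add_term :: "int \<Rightarrow> int \<Rightarrow> aff \<Rightarrow> (aff list \<times> thresholds) option \<Rightarrow> (aff list \<times> thresholds) option" where
  "add_term P Q a None = None"
| "add_term P Q a (Some (rs, ds)) =
     (case discard P Q a ds of
        Some ds' \<Rightarrow> Some (rs, ds')
      | None \<Rightarrow> map_option (\<lambda>rs'. (rs', ds)) (insert_sorted P Q a rs))"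

text \<open>Discarded terms are only known to lie above some threshold. Hence \<open>r\<close> is
  certain to be the least upper term only while it does not exceed any threshold.\<close>

fun below_open :: "int \<Rightarrow> int \<Rightarrow> aff \<Rightarrow> thresholds \<Rightarrow> bool" where
  "below_open P Q r [] = True"
| "below_open P Q r ((d, k) # ds) = ((if 2 \<le> k then True else geq P Q d r) \<and> below_open P Q r ds)"

text \<open>Two steps of the sequence at once. With \<open>n\<close> odd, \<open>c\<close> the median of \<open>n\<close> terms and \<open>r\<close> the next larger
  term, the medians are \<open>c\<close>, \<open>(c + r) / 2\<close>, \<open>r\<close>, so the two new terms are \<open>c + p\<close> and \<open>r + p\<close>
  where \<open>p = (n + 2) * (r - c) / 2\<close>. Values of \<open>t\<close> at which \<open>r\<close> exceeds a threshold counted at least twice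
  need no further attention: there the median moves to the least threshold and stays.\<close>

fun step :: "int \<Rightarrow> int \<Rightarrow> state option \<Rightarrow> state option" where
  "step P Q None = None"
| "step P Q (Some (n, c, [], ds)) = Some (n, c, [], ds)"
| "step P Q (Some (n, (u, v), (u', v') # rs, ds)) =
     (if below_open P Q (u', v') ds \<and> even (u' - u) \<and> even (v' - v)
      then let pu = (n + 2) * ((u' - u) div 2); pv = (n + 2) * ((v' - v) div 2)
        in map_option (\<lambda>(rs', ds'). (n + 2, (u', v'), rs', ds'))
             (add_term P Q (u + pu, v + pv) (add_term P Q (u' + pu, v' + pv) (Some (rs, ds))))
      else None)"

fun run :: "nat \<Rightarrow> int \<Rightarrow> int \<Rightarrow> state option \<Rightarrow> state option" where
  "run 0 P Q s = s"
| "run (Suc k) P Q s = run k P Q (step P Q s)"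

fun saturated :: "state option \<Rightarrow> bool" where
  "saturated None = False"
| "saturated (Some (n, c, rs, ds)) = (rs = [] \<and> list_all (\<lambda>(d, k). 2 \<le> k) ds)"

text \<open>From \<open>x = (p + s * t) / q\<close>: the median of three terms is \<open>x\<close>,
  and above it lie \<open>1\<close> and the fourth term \<open>3 * x - 1\<close>, all multiplied by
  \<open>B * q\<close>.\<close>

definition start :: "int \<Rightarrow> int \<Rightarrow> int \<Rightarrow> int \<Rightarrow> int \<Rightarrow> int \<Rightarrow> thresholds \<Rightarrow> state option" where
  "start p q s B P Q ds = map_option (\<lambda>(rs, ds'). (3, (B * p, B * s), rs, ds'))
     (add_term P Q (B * q, 0) (add_term P Q (B * (3 * p - q), B * (3 * s)) (Some ([], ds))))"

text \<open>The coordinate is \<open>t = s * (q * x - p)\<close> with \<open>s = 1\<close> to the right and \<open>s = - 1\<close> to the left of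
  \<open>p / q\<close>. All terms are multiplied by \<open>B * q\<close>, with \<open>B\<close> a power of two large enough to absorb the
  halvings in \<open>step\<close>.\<close>

definition certified :: "int \<Rightarrow> int \<Rightarrow> int \<Rightarrow> int \<Rightarrow> int \<Rightarrow> int \<Rightarrow> nat \<Rightarrow> aff list \<Rightarrow> bool" where
  "certified p q s B P Q N ds \<longleftrightarrow> saturated (run N P Q (start p q s B P Q (map (\<lambda>d. (d, 0)) ds)))"

section \<open>Soundness of the symbolic run at a fixed value of \<open>t\<close>\<close>

lemma geq_value_at:
  assumes "geq P Q a b" "0 < Q" "0 \<le> t" "t * of_int Q \<le> of_int P"
  shows "value_at t b \<le> value_at t a"
proof -
  obtain u v u' v' where ab: "a = (u, v)" "b = (u', v')" by (metis surj_pair)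
  show ?thesis
  proof (cases "v' \<le> v")
    case True
    moreover have "u' \<le> u" using assms(1) by (auto simp: ab split: if_splits)
    ultimately show ?thesis
      using assms(3) by (auto simp: ab value_at_def intro!: add_mono mult_right_mono)
  next
    case False
    hence "(v' - v) * P \<le> (u - u') * Q" using assms(1) by (auto simp: ab split: if_splits)
    hence 1: "real_of_int (v' - v) * of_int P \<le> of_int (u - u') * of_int Q"
      by (metis of_int_le_iff of_int_mult)
    \<comment> \<open>The gap between the two functions shrinks as \<open>t\<close> grows, so the
      far end \<open>P / Q\<close> is the worst case.\<close>
    have "real_of_int (v' - v) * (t * of_int Q) \<le> real_of_int (v' - v) * of_int P"
      using False assms(4) by (intro mult_left_mono) auto
    with 1 have "(of_int (v' - v) * t) * real_of_int Q \<le> of_int (u - u') * of_int Q"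
      by (simp add: mult.assoc)
    hence "of_int (v' - v) * t \<le> real_of_int (u - u')"
      using assms(2) by simp
    thus ?thesis by (simp add: ab value_at_def algebra_simps)
  qed
qed

lemma cons_option_eq_Some:
  "cons_option x o1 = Some ys \<longleftrightarrow> (\<exists>xs. o1 = Some xs \<and> ys = x # xs)"
  by (cases o1) auto

context
  fixes P Q :: int and t :: real
  assumes Q: "0 < Q" and t: "0 \<le> t" "t * of_int Q \<le> of_int P"
begin

lemma geq_D: "geq P Q a b \<Longrightarrow> value_at t b \<le> value_at t a"
  using geq_value_at Q t by blast

lemma insert_sorted_mset:
  "insert_sorted P Q a rs = Some rs' \<Longrightarrow> mset rs' = add_mset a (mset rs)"
  by (induction rs arbitrary: rs') (auto simp: cons_option_eq_Some split: if_splits)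

lemma insert_sorted_sorted:
  assumes "insert_sorted P Q a rs = Some rs'" "sorted (map (value_at t) rs)"
  shows "sorted (map (value_at t) rs')"
  using assms
proof (induction rs arbitrary: rs')
  case (Cons r rs)
  show ?case
  proof (cases "geq P Q a r")
    case True
    then obtain xs where xs: "insert_sorted P Q a rs = Some xs" "rs' = r # xs"
      using Cons.prems(1) by (auto simp: cons_option_eq_Some)
    have "set xs = insert a (set rs)"
      using insert_sorted_mset[OF xs(1)] by (metis set_mset_add_mset_insert set_mset_mset)
    thus ?thesis
      using Cons.IH[OF xs(1)] Cons.prems(2) geq_D[OF True] by (auto simp: xs(2))
  next
    case False
    hence "geq P Q r a" "rs' = a # r # rs" using Cons.prems(1) by (auto split: if_splits)
    thus ?thesis using Cons.prems(2) geq_D[of r a] by (auto intro: order_trans)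
  qed
qed auto

text \<open>A list of terms sorted at \<open>t\<close>, together with terms known only to lie above some threshold;
  the counters are lower bounds for the multiplicities of the thresholds among the latter.\<close>

definition represents :: "real multiset \<Rightarrow> aff list \<Rightarrow> thresholds \<Rightarrow> bool" where
  "represents X rs ds \<longleftrightarrow> (\<exists>Z. X = image_mset (value_at t) (mset rs) + Z \<and> sorted (map (value_at t) rs) \<and>
     (\<forall>z\<in>#Z. \<exists>d\<in>fst ` set ds. value_at t d \<le> z) \<and> (\<forall>(d, k)\<in>set ds. k \<le> count Z (value_at t d)))"

lemma discard_Some:
  assumes "discard P Q a ds = Some ds'"
  shows "map fst ds' = map fst ds" "\<exists>d\<in>fst ` set ds. value_at t d \<le> value_at t a"
    "\<forall>(d, k)\<in>set ds. k \<le> count Z (value_at t d) \<Longrightarrow>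
       \<forall>(d, k)\<in>set ds'. k \<le> count (add_mset (value_at t a) Z) (value_at t d)"
  using assms
  by (induction ds arbitrary: ds')
    (force simp: cons_option_eq_Some dest: geq_D split: if_splits)+

lemma add_term_Some:
  assumes "add_term P Q a (Some (rs, ds)) = Some (rs', ds')" "represents X rs ds"
  shows "represents (add_mset (value_at t a) X) rs' ds'" "map fst ds' = map fst ds"
proof -
  obtain Z where Z: "X = image_mset (value_at t) (mset rs) + Z" "sorted (map (value_at t) rs)"
     "\<forall>z\<in>#Z. \<exists>d\<in>fst ` set ds. value_at t d \<le> z" "\<forall>(d, k)\<in>set ds. k \<le> count Z (value_at t d)"
    using assms(2) unfolding represents_def by blast
  have "represents (add_mset (value_at t a) X) rs' ds' \<and> map fst ds' = map fst ds"
  proof (cases "discard P Q a ds")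
    case None
    hence ins: "insert_sorted P Q a rs = Some rs'" "ds' = ds" using assms(1) by auto
    show ?thesis
      unfolding represents_def using insert_sorted_mset[OF ins(1)] insert_sorted_sorted[OF ins(1) Z(2)] Z
      by (intro conjI exI[of _ Z]) (auto simp: ins(2))
  next
    case (Some ds1)
    hence eq: "rs' = rs" "ds' = ds1" using assms(1) by auto
    note d = discard_Some[OF Some]
    have fst: "fst ` set ds1 = fst ` set ds" using d(1) by (metis list.set_map)
    show ?thesis
      unfolding represents_def eq using Z(1-3) d(1,2) d(3)[OF Z(4)]
      by (intro conjI exI[of _ "add_mset (value_at t a) Z"]) (auto simp: fst)
  qed
  thus "represents (add_mset (value_at t a) X) rs' ds'" "map fst ds' = map fst ds" by blast+
qed

lemma add_term_None: "add_term P Q a x = Some y \<Longrightarrow> \<exists>rs ds. x = Some (rs, ds)"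
  by (cases x) auto

lemma add_term_twice:
  assumes "add_term P Q a (add_term P Q b (Some (rs, ds))) = Some (rs', ds')" "represents X rs ds"
  shows "represents (X + {#value_at t a, value_at t b#}) rs' ds'" "map fst ds' = map fst ds"
proof -
  obtain rs1 ds1 where b: "add_term P Q b (Some (rs, ds)) = Some (rs1, ds1)"
    using add_term_None[OF assms(1)] by blast
  note 1 = add_term_Some[OF b assms(2)]
  note 2 = add_term_Some[OF assms(1)[unfolded b] 1(1)]
  show "represents (X + {#value_at t a, value_at t b#}) rs' ds'" "map fst ds' = map fst ds"
    using 1 2 by (simp_all add: add_mset_commute)
qed

lemma below_open_D:
  "below_open P Q r ds \<Longrightarrow> (d, k) \<in> set ds \<Longrightarrow> 2 \<le> k \<or> value_at t r \<le> value_at t d"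
  by (induction ds) (auto dest: geq_D split: if_splits)

text \<open>An aborted run tracks vacuously; it is ruled out at the end because
  \<open>saturated None\<close> is false.\<close>

fun tracks :: "(nat \<Rightarrow> real) \<Rightarrow> aff list \<Rightarrow> state option \<Rightarrow> bool" where
  "tracks w ds0 None = True"
| "tracks w ds0 (Some (n, c, rs, ds)) \<longleftrightarrow> map fst ds = ds0 \<and>
     (\<exists>m X. n = int m \<and> upper_part w m (value_at t c) X \<and> represents X rs ds)"

text \<open>Every retained or discarded term is at least the smallest threshold value, and this
  value occurs twice. The counter condition concerns only thresholds attaining the minimum at this
  \<open>t\<close>, as \<open>below_open\<close> gives no information on the counters of larger
  ones.\<close>

lemma stabilizes_at_threshold:
  assumes w: "mm_like w" and up: "upper_part w m c X" and rep: "represents X rs ds"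
    and ds: "ds \<noteq> []" "ds0 = map fst ds"
    and above: "\<forall>r\<in>set rs. Min (value_at t ` set ds0) \<le> value_at t r"
    and double: "\<And>d k. (d, k) \<in> set ds \<Longrightarrow> value_at t d = Min (value_at t ` set ds0) \<Longrightarrow> 2 \<le> k"
  shows "stabilizes w (Min (value_at t ` set ds0))"
proof -
  let ?v = "Min (value_at t ` set ds0)"
  have fin: "finite (value_at t ` set ds0)" "value_at t ` set ds0 \<noteq> {}" using ds by auto
  from Min_in[OF fin] obtain d k where d: "(d, k) \<in> set ds" "value_at t d = ?v"
    using ds(2) by auto
  obtain Z where Z: "X = image_mset (value_at t) (mset rs) + Z"
    "\<forall>z\<in>#Z. \<exists>d\<in>fst ` set ds. value_at t d \<le> z" "\<forall>(d, k)\<in>set ds. k \<le> count Z (value_at t d)"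
    using rep unfolding represents_def by blast
  have "2 \<le> count Z ?v" using double[OF d] Z(3) d by fastforce
  moreover have "?v \<le> z" if z: "z \<in># Z" for z
  proof -
    obtain d where "d \<in> set ds0" "value_at t d \<le> z" using Z(2) z unfolding ds(2) set_map by blast
    thus ?thesis using fin by (meson Min_le finite_imageI imageI order_trans)
  qed
  ultimately show ?thesis
    using above by (intro upper_part_stabilizes[OF w up]) (auto simp: Z(1))
qed

lemma step_tracks:
  assumes w: "mm_like w" and s: "tracks w ds0 s" and ds0: "ds0 \<noteq> []"
  shows "tracks w ds0 (step P Q s) \<or> stabilizes w (Min (value_at t ` set ds0))"
proof (cases "\<exists>n u v u' v' rs ds. s = Some (n, (u, v), (u', v') # rs, ds) \<and> step P Q s \<noteq> None")
  case False
  have "step P Q s = s \<or> step P Q s = None"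
  proof (cases "(P, Q, s)" rule: step.cases)
    case (3 P' Q' n u v u' v' rs ds)
    hence "s = Some (n, (u, v), (u', v') # rs, ds)" by simp
    with False show ?thesis by metis
  qed auto
  thus ?thesis using s by auto
next
  case True
  then obtain n u v u' v' rs ds where s_eq: "s = Some (n, (u, v), (u', v') # rs, ds)"
    and "step P Q s \<noteq> None" by blast
  define pu pv where "pu = (n + 2) * ((u' - u) div 2)" and "pv = (n + 2) * ((v' - v) div 2)"
  have ok: "below_open P Q (u', v') ds" "even (u' - u)" "even (v' - v)"
    using \<open>step P Q s \<noteq> None\<close> by (auto simp: s_eq split: if_splits)
  with \<open>step P Q s \<noteq> None\<close> obtain rs' ds' where
    add: "add_term P Q (u + pu, v + pv) (add_term P Q (u' + pu, v' + pv) (Some (rs, ds))) = Some (rs', ds')"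
    and step: "step P Q s = Some (n + 2, (u', v'), rs', ds')"
    by (auto simp: s_eq pu_def pv_def Let_def simp del: add_term.simps)
  obtain m X where m: "n = int m" and up: "upper_part w m (value_at t (u, v)) X"
    and rep: "represents X ((u', v') # rs) ds" and ds: "map fst ds = ds0"
    using s by (auto simp: s_eq)
  let ?r = "value_at t (u', v')"
  obtain Z where Z: "X = image_mset (value_at t) (mset ((u', v') # rs)) + Z"
    "sorted (map (value_at t) ((u', v') # rs))"
    "\<forall>z\<in>#Z. \<exists>d\<in>fst ` set ds. value_at t d \<le> z" "\<forall>(d, k)\<in>set ds. k \<le> count Z (value_at t d)"
    using rep unfolding represents_def by blast
  show ?thesis
  \<comment> \<open>Either \<open>r\<close> lies below all discarded terms and is the true next
    median, or it has passed the least threshold. In that case the symbolic step no longer describes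
    the sequence at this \<open>t\<close>, but the threshold it passed was already counted
    twice.\<close>
  proof (cases "?r \<le> Min (value_at t ` set ds0)")
    case True
    have r: "?r \<in># X" "\<forall>y\<in>#X. ?r \<le> y"
    proof -
      have "?r \<le> value_at t d" if "d \<in> set ds0" for d
        using True that by (meson Min_le List.finite_set finite_imageI imageI order_trans)
      hence "?r \<le> z" if "z \<in># Z" for z
        using Z(3) that unfolding ds[symmetric] set_map by (meson order_trans)
      thus "\<forall>y\<in>#X. ?r \<le> y"
        using Z(2) by (auto simp: Z(1))
    qed (simp add: Z(1))
    define p where "p = real (m + 2) * ((?r - value_at t (u, v)) / 2)"
    have half: "real_of_int (k div 2) = of_int k / 2" if "even k" for k
      using that by (auto elim!: evenE)
    have p: "value_at t (u + pu, v + pv) = value_at t (u, v) + p" "value_at t (u' + pu, v' + pv) = ?r + p"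
      unfolding p_def pu_def pv_def value_at_def m by (simp_all add: half[OF ok(2)] half[OF ok(3)] field_simps)
    have rep1: "represents (X - {#?r#}) rs ds"
      unfolding represents_def using Z by (intro exI[of _ Z]) auto
    show ?thesis
      using upper_part_step(3)[OF w up r p_def] add_term_twice[OF add rep1] ds
      by (auto simp: step p m intro!: exI[of _ "m + 2"])
  next
    case False
    have "stabilizes w (Min (value_at t ` set ds0))"
    proof (rule stabilizes_at_threshold[OF w up rep])
      show "\<forall>r\<in>set ((u', v') # rs). Min (value_at t ` set ds0) \<le> value_at t r"
        using False Z(2) by fastforce
      show "2 \<le> k" if "(d, k) \<in> set ds" "value_at t d = Min (value_at t ` set ds0)" for d k
        using below_open_D[OF ok(1) that(1)] that(2) False by simp
    qed (use ds ds0 in auto)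
    thus ?thesis ..
  qed
qed

lemma run_stabilizes:
  assumes w: "mm_like w" and "tracks w ds0 s" and ds0: "ds0 \<noteq> []" and "saturated (run k P Q s)"
  shows "stabilizes w (Min (value_at t ` set ds0))"
  using assms(2,4)
proof (induction k arbitrary: s)
  case 0
  then obtain n c ds where s: "s = Some (n, c, [], ds)" "list_all (\<lambda>(d, k). 2 \<le> k) ds"
    by (cases s) auto
  then obtain m X where "upper_part w m (value_at t c) X" "represents X [] ds" "map fst ds = ds0"
    using "0.prems"(1) by auto
  thus ?case
    using stabilizes_at_threshold[OF w, of m "value_at t c" X "[]" ds ds0] s(2) ds0
    by (auto simp: list_all_iff)
next
  case (Suc k)
  thus ?case using step_tracks[OF w Suc.prems(1) ds0] by auto
qed

end

section \<open>The mean-median map\<close>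

lemma mm_seq_initial: "mm_seq x (Suc 0) = 0" "mm_seq x 2 = x" "mm_seq x 3 = 1"
  by (simp_all add: mm_seq.simps)

lemma upt_1_4: "[1..<Suc 3] = [1, 2, 3]"
  by (simp add: upt_rec numeral_2_eq_2 numeral_3_eq_3)

lemma mm_like_affine_mm_seq: "mm_like (\<lambda>n. a * mm_seq x n + b)"
  unfolding mm_like_def
proof (intro allI impI)
  fix n :: nat
  assume n: "4 \<le> n"
  have "med (map (\<lambda>n. a * mm_seq x n + b) [1..<n]) = a * mm_median x (n - 1) + b"
    using med_affine[of "map (mm_seq x) [1..<n]" a b] n by (simp add: mm_median_def o_def)
  thus "(\<Sum>i=1..n. a * mm_seq x i + b) = real n * med (map (\<lambda>n. a * mm_seq x n + b) [1..<n])"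
    using mm_seq_mean[OF n, of x] n by (simp add: sum.distrib field_simps flip: sum_distrib_left)
qed

lemma mm_like_mm_seq: "mm_like (mm_seq x)"
  using mm_like_affine_mm_seq[of 1 x 0] by simp

text \<open>This also yields the fourth term, for which there is no earlier mean equation to
  subtract.\<close>

lemma mm_like_Suc:
  assumes "mm_like w" "3 \<le> n"
  shows "w (Suc n) = real (Suc n) * med (map w [1..<Suc n]) - sum_list (map w [1..<Suc n])"
proof -
  have "(\<Sum>i=1..Suc n. w i) = real (Suc n) * med (map w [1..<Suc n])"
    using assms(1)[unfolded mm_like_def, rule_format, of "Suc n"] assms(2) by (simp del: upt_Suc)
  moreover have "(\<Sum>i=1..n. w i) = sum_list (map w [1..<Suc n])"
    by (simp only: sum_set_upt_conv_sum_list_nat[symmetric] atLeastLessThanSuc_atLeastAtMost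
        atLeastLessThan_upt[symmetric])
  ultimately show ?thesis by simp
qed

text \<open>Sum and median are symmetric, so the order of the first three terms has no influence on
  the later ones.\<close>

lemma mm_like_determined:
  assumes f: "mm_like f" and g: "mm_like g"
    and 3: "mset (map f [1..<Suc 3]) = mset (map g [1..<Suc 3])" and "3 \<le> n"
  shows "mset (map f [1..<Suc n]) = mset (map g [1..<Suc n]) \<and> f (Suc n) = g (Suc n)"
  using \<open>3 \<le> n\<close>
proof (induction n rule: dec_induct)
  have Suc: "f (Suc n) = g (Suc n)"
    if "3 \<le> n" "mset (map f [1..<Suc n]) = mset (map g [1..<Suc n])" for n
    using mm_like_Suc[OF f that(1)] mm_like_Suc[OF g that(1)]
      med_mset_cong[OF that(2)] arg_cong[OF that(2), of sum_mset]
    by (simp only: sum_mset_sum_list)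
  {
    case base
    show ?case using 3 Suc[OF order_refl 3] by blast
  next
    case (step n)
    hence "mset (map f [1..<Suc (Suc n)]) = mset (map g [1..<Suc (Suc n)])" by simp
    thus ?case using Suc[of "Suc n"] step.hyps by simp
  }
qed

lemma upper_part_mm_seq:
  assumes "1 / 2 \<le> x" "x \<le> 1" "0 < S"
  shows "upper_part (\<lambda>n. S * mm_seq x n) 3 (S * x) {#S, S * (3 * x - 1)#}"
proof -
  define w where "w = (\<lambda>n. S * mm_seq x n)"
  have w: "mm_like w" using mm_like_affine_mm_seq[of S x 0] by (simp add: w_def)
  have w3: "w 1 = 0" "w 2 = S * x" "w 3 = S"
    by (simp_all add: w_def mm_seq_initial)
  have l3: "map w [1..<Suc 3] = [0, S * x, S]"
    using w3 unfolding upt_1_4 by simp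
  have "mset (map w [1..<Suc 3]) = {#0#} + {#S * x#} + {#S#}"
    unfolding l3 by simp
  from med_odd[OF this] have m3: "med (map w [1..<Suc 3]) = S * x"
    using assms by (auto simp: mult_le_cancel_left1)
  have "w (Suc 3) = S * (3 * x - 1)"
    using mm_like_Suc[OF w, of 3] m3 by (simp only: l3) (simp add: algebra_simps)
  hence ms: "mset (map w [1..<Suc (Suc 3)]) = {#0#} + {#S * x#} + {#S, S * (3 * x - 1)#}"
    by (subst upt_Suc_append) (simp_all only: map_append l3, simp_all)
  \<comment> \<open>The bound \<open>1 / 2 \<le> x\<close> enters here: it is equivalent to
    \<open>x \<le> 3 * x - 1\<close>.\<close>
  have "S * x \<le> S" "S * x \<le> S * (3 * x - 1)" "0 \<le> S * x"
    using assms by (auto simp: mult_le_cancel_left1)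
  thus ?thesis
    unfolding upper_part_def w_def[symmetric] using m3 ms
    by (auto intro!: exI[of _ "{#0#}"] simp del: upt_Suc)
qed

lemma stabilizes_scale:
  assumes "stabilizes (\<lambda>n. S * mm_seq x n) (S * v)" "0 < S"
  shows "stabilizes (mm_seq x) v"
proof -
  have "med (map (\<lambda>n. S * mm_seq x n) [1..<Suc n]) = S * med (map (mm_seq x) [1..<Suc n])"
    if "1 \<le> n" for n
    using med_affine[of "map (mm_seq x) [1..<Suc n]" S 0] that by (simp add: o_def del: upt_Suc)
  thus ?thesis using assms unfolding stabilizes_def by (metis le_trans mult_left_cancel less_irrefl)
qed

lemma stabilizes_reflect:
  assumes "stabilizes (mm_seq (1 - x)) v"
  shows "stabilizes (mm_seq x) (1 - v)"
proof -
  define g where "g = (\<lambda>n. - 1 * mm_seq (1 - x) n + 1)"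
  have g: "mm_like g" unfolding g_def by (rule mm_like_affine_mm_seq)
  \<comment> \<open>The reflected sequence starts with \<open>1, x, 0\<close> instead of
    \<open>0, x, 1\<close>, so it agrees with \<open>mm_seq x\<close> only from the fourth term
    on.\<close>
  have "g 1 = 1" "g 2 = x" "g 3 = 0" by (simp_all add: g_def mm_seq_initial)
  hence 3: "mset (map (mm_seq x) [1..<Suc 3]) = mset (map g [1..<Suc 3])"
    unfolding upt_1_4 by (simp add: mm_seq_initial)
  note det = mm_like_determined[OF mm_like_mm_seq g 3]
  obtain N where N: "\<And>n. N \<le> n \<Longrightarrow> mm_seq (1 - x) n = v \<and> med (map (mm_seq (1 - x)) [1..<Suc n]) = v"
    using assms unfolding stabilizes_def by blast
  have "mm_seq x n = 1 - v \<and> med (map (mm_seq x) [1..<Suc n]) = 1 - v" if n: "N + 4 \<le> n" for n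
  proof
    obtain m where m: "n = Suc m" "3 \<le> m" using n by (cases n) auto
    show "mm_seq x n = 1 - v" using det[OF m(2)] N[of n] n by (simp add: m(1) g_def)
    have "med (map (mm_seq x) [1..<Suc n]) = med (map g [1..<Suc n])"
      using det[of n] n by (intro med_mset_cong) simp
    also have "\<dots> = 1 - v"
      using med_affine[of "map (mm_seq (1 - x)) [1..<Suc n]" "- 1" 1] N[of n] n
      by (simp add: g_def o_def del: upt_Suc)
    finally show "med (map (mm_seq x) [1..<Suc n]) = 1 - v" .
  qed
  thus ?thesis unfolding stabilizes_def by (intro exI[of _ "N + 4"]) (auto simp del: upt_Suc)
qed

lemma stabilizes_mm_length: "stabilizes (mm_seq x) v \<Longrightarrow> mm_length x < \<infinity>"
proof -
  assume "stabilizes (mm_seq x) v"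
  then obtain N where "1 \<le> N" "\<forall>n\<ge>N. mm_seq x n = v" unfolding stabilizes_def by blast
  hence "mm_length x \<le> enat N" unfolding mm_length_def by (intro Inf_lower) auto
  thus ?thesis by (rule order_le_less_trans) simp
qed

lemma stabilizes_mm_median: "stabilizes (mm_seq x) v \<Longrightarrow> mm_median x \<longlonglongrightarrow> v"
  unfolding stabilizes_def mm_median_def
  by (rule tendsto_eventually) (auto simp: eventually_sequentially simp del: upt_Suc)

definition stabilizes_on :: "real set \<Rightarrow> (real \<Rightarrow> real) \<Rightarrow> bool" where
  "stabilizes_on A f \<longleftrightarrow> (\<forall>x\<in>A. stabilizes (mm_seq x) (f x))"

lemma stabilizes_onD: 
  assumes "stabilizes_on A f" "x \<in> A"
  shows "mm_length x < \<infinity>" "convergent (mm_median x)" "mm_map x = f x"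
proof -
  have st: "stabilizes (mm_seq x) (f x)" using assms unfolding stabilizes_on_def by blast
  show "mm_length x < \<infinity>" by (rule stabilizes_mm_length[OF st])
  show "convergent (mm_median x)" by (rule convergentI[OF stabilizes_mm_median[OF st]])
  show "mm_map x = f x" unfolding mm_map_def by (rule limI[OF stabilizes_mm_median[OF st]])
qed

lemma stabilizes_on_imp_given: "stabilizes_on A f \<Longrightarrow> mm_map_given_on A f"
  unfolding mm_map_given_on_def by (simp add: stabilizes_onD)

lemma stabilizes_on_cong:
  "stabilizes_on B g \<Longrightarrow> A \<subseteq> B \<Longrightarrow> (\<And>x. x \<in> A \<Longrightarrow> f x = g x) \<Longrightarrow> stabilizes_on A f"
  unfolding stabilizes_on_def by (metis subsetD)

lemma stabilizes_on_Un:
  "stabilizes_on A f \<Longrightarrow> stabilizes_on B f \<Longrightarrow> stabilizes_on (A \<union> B) f"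
  unfolding stabilizes_on_def by blast

lemma stabilizes_on_reflect:
  "stabilizes_on {a..b} f \<Longrightarrow> stabilizes_on {1 - b..1 - a} (\<lambda>x. 1 - f (1 - x))"
  unfolding stabilizes_on_def by (auto intro!: stabilizes_reflect)

text \<open>On closed pieces continuity glues; \<open>f c\<close> and \<open>g c\<close> are limits
  of the same medians and therefore agree.\<close>

lemma continuous_neighbourhood:
  assumes "stabilizes_on {a..c} f" "stabilizes_on {c..b} g"
    and "continuous_on {a..c} f" "continuous_on {c..b} g"
    and "0 \<le> a" "a < c" "c < b" "b \<le> 1"
  shows "\<exists>U. open U \<and> c \<in> U \<and> U \<subseteq> {0<..<1} \<and> (\<forall>x\<in>U. mm_length x < \<infinity>) \<and> continuous_on U mm_map"
proof (intro exI conjI)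
  have "continuous_on {a..c} mm_map" "continuous_on {c..b} mm_map"
    using assms(1-4) by (auto simp: stabilizes_onD(3) cong: continuous_on_cong_simp)
  hence "continuous_on ({a..c} \<union> {c..b}) mm_map"
    by (intro continuous_on_closed_Un) auto
  thus "continuous_on {a<..<b} mm_map"
    by (rule continuous_on_subset) auto
  show "\<forall>x\<in>{a<..<b}. mm_length x < \<infinity>"
    using stabilizes_onD(1)[OF assms(1)] stabilizes_onD(1)[OF assms(2)]
    by (meson atLeastAtMost_iff greaterThanLessThan_iff less_imp_le linear)
qed (use assms(5-8) in auto)

text \<open>One run serves all \<open>t\<close> in the range, although the time at which the
  sequence becomes constant may depend on \<open>t\<close>.\<close>

lemma certified_stabilizes:
  assumes cert: "certified p q s B P Q N ds" and pos: "0 < q" "0 < B" "0 < Q" and ds: "ds \<noteq> []"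
    and s: "s * s = 1" and x: "1 / 2 \<le> x" "x \<le> 1"
    and t: "0 \<le> of_int s * (of_int q * x - of_int p)"
      "of_int s * (of_int q * x - of_int p) * of_int Q \<le> real_of_int P"
  shows "stabilizes (mm_seq x)
     (Min (value_at (of_int s * (of_int q * x - of_int p)) ` set ds) / (of_int B * of_int q))"
proof -
  define t where "t = of_int s * (of_int q * x - of_int p)"
  define S where "S = real_of_int B * of_int q"
  define w where "w = (\<lambda>n. S * mm_seq x n)"
  have S: "0 < S" using pos by (simp add: S_def)
  have w: "mm_like w" using mm_like_affine_mm_seq[of S x 0] by (simp add: w_def)
  have "real_of_int s * of_int s = 1" using s by (metis of_int_1 of_int_mult)
  hence "of_int s * t = of_int q * x - of_int p"
    by (simp add: t_def flip: mult.assoc)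
  hence X: "value_at t (B * p, B * s) = S * x" "value_at t (B * q, 0) = S"
    "value_at t (B * (3 * p - q), B * (3 * s)) = S * (3 * x - 1)"
    by (simp_all add: value_at_def S_def mult.assoc) (simp_all add: algebra_simps)
  let ?ds = "map (\<lambda>d. (d, 0)) ds"
  have rep: "represents t {#} [] ?ds"
    unfolding represents_def[OF pos(3) t[folded t_def]] by auto
  have "tracks t w ds (start p q s B P Q ?ds)"
  proof (cases "start p q s B P Q ?ds")
    case None
    thus ?thesis using tracks.simps(1)[OF pos(3) t[folded t_def]] by simp
  next
    case (Some st)
    then obtain rs ds' where
      add: "add_term P Q (B * q, 0) (add_term P Q (B * (3 * p - q), B * (3 * s)) (Some ([], ?ds))) = Some (rs, ds')"
      and st: "st = (3, (B * p, B * s), rs, ds')"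
      unfolding start_def by auto
    from add_term_twice[OF pos(3) t[folded t_def] add rep] upper_part_mm_seq[OF x S]
    show ?thesis 
      unfolding Some st tracks.simps(2)[OF pos(3) t[folded t_def]] X w_def
      by (auto simp: o_def intro!: exI[of _ 3])
  qed
  from run_stabilizes[OF pos(3) t[folded t_def] w this ds] cert
  have "stabilizes w (S * (Min (value_at t ` set ds) / S))"
    using S by (simp add: certified_def)
  from stabilizes_scale[OF this[unfolded w_def] S] show ?thesis by (simp add: t_def S_def)
qed

section \<open>Evaluation\<close>

text \<open>Conditionals and case distinctions are replaced by conditional equations and pattern matching
  on auxiliary constants: the simplifier would otherwise traverse the long lists of numerals again
  after every choice of a branch.\<close>

lemma geq_simps:
  "u' < u \<Longrightarrow> v < v' \<Longrightarrow> geq P Q (u, v) (u', v') = ((v' - v) * P \<le> (u - u') * Q)"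
  "u' < u \<Longrightarrow> v' \<le> v \<Longrightarrow> geq P Q (u, v) (u', v') = True"
  "u < u' \<Longrightarrow> geq P Q (u, v) (u', v') = False"
  "geq P Q (u, v) (u, v') = (v' \<le> v)"
  by auto

lemma insert_sorted_simps:
  "insert_sorted P Q a [] = Some [a]"
  "\<not> geq P Q a r \<Longrightarrow> geq P Q r a \<Longrightarrow> insert_sorted P Q a (r # rs) = Some (a # r # rs)"
  "geq P Q a r \<Longrightarrow> insert_sorted P Q a (r # rs) = cons_option r (insert_sorted P Q a rs)"
  by auto

lemma discard_simps:
  "discard P Q a [] = None"
  "a \<noteq> d \<Longrightarrow> \<not> geq P Q a d \<Longrightarrow> discard P Q a ((d, k) # ds) = cons_option (d, k) (discard P Q a ds)"
  "a \<noteq> d \<Longrightarrow> geq P Q a d \<Longrightarrow> discard P Q a ((d, k) # ds) = Some ((d, k) # ds)"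
  "discard P Q a ((a, k) # ds) = Some ((a, Suc k) # ds)"
  by auto

definition with_thresholds :: "thresholds \<Rightarrow> aff list option \<Rightarrow> (aff list \<times> thresholds) option" where
  "with_thresholds ds = map_option (\<lambda>rs. (rs, ds))"

definition retain ::
    "int \<Rightarrow> int \<Rightarrow> aff \<Rightarrow> aff list \<Rightarrow> thresholds \<Rightarrow> thresholds option \<Rightarrow> (aff list \<times> thresholds) option" where
  "retain P Q a rs ds x =
    (case x of Some ds' \<Rightarrow> Some (rs, ds') | None \<Rightarrow> with_thresholds ds (insert_sorted P Q a rs))"

lemma add_term_simps:
  "add_term P Q a (Some (rs, ds)) = retain P Q a rs ds (discard P Q a ds)"
  "retain P Q a rs ds (Some ds') = Some (rs, ds')"
  "retain P Q a rs ds None = with_thresholds ds (insert_sorted P Q a rs)"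
  "with_thresholds ds (Some rs) = Some (rs, ds)"
  by (simp_all add: retain_def with_thresholds_def split: option.split)

definition advance :: "int \<Rightarrow> aff \<Rightarrow> (aff list \<times> thresholds) option \<Rightarrow> state option" where
  "advance n c = map_option (\<lambda>(rs, ds). (n, c, rs, ds))"

definition half :: "int \<Rightarrow> int option" where
  "half k = (if even k then Some (k div 2) else None)"

definition move :: "int \<Rightarrow> int \<Rightarrow> int \<Rightarrow> aff \<Rightarrow> aff \<Rightarrow> int \<Rightarrow> int \<Rightarrow> aff list \<Rightarrow> thresholds \<Rightarrow> state option" where
  "move P Q n c r pu pv rs ds = advance (n + 2) r
     (add_term P Q (fst c + pu, snd c + pv) (add_term P Q (fst r + pu, snd r + pv) (Some (rs, ds))))"

text \<open>Only the successful outcome receives an equation in \<open>step_simps\<close>; a failed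
  check leaves an irreducible term and no proof.\<close>

definition branch ::
    "bool \<Rightarrow> int option \<Rightarrow> int option \<Rightarrow> int \<Rightarrow> int \<Rightarrow> int \<Rightarrow> aff \<Rightarrow> aff \<Rightarrow> aff list \<Rightarrow> thresholds \<Rightarrow> state option" where
  "branch b x y P Q n c r rs ds =
    (case (b, x, y) of (True, Some hu, Some hv) \<Rightarrow> move P Q n c r ((n + 2) * hu) ((n + 2) * hv) rs ds
       | _ \<Rightarrow> None)"

lemma step_simps:
  "step P Q (Some (n, c, [], ds)) = Some (n, c, [], ds)"
  "step P Q (Some (n, (u, v), (u', v') # rs, ds)) =
     branch (below_open P Q (u', v') ds) (half (u' - u)) (half (v' - v)) P Q n (u, v) (u', v') rs ds"
  "branch True (Some hu) (Some hv) P Q n c r rs ds = move P Q n c r ((n + 2) * hu) ((n + 2) * hv) rs ds"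
  "move P Q n (u, v) (u', v') pu pv rs ds = advance (n + 2) (u', v')
     (add_term P Q (u + pu, v + pv) (add_term P Q (u' + pu, v' + pv) (Some (rs, ds))))"
  "advance n c (Some (rs, ds)) = Some (n, c, rs, ds)"
  by (auto simp: branch_def half_def move_def advance_def Let_def simp del: add_term.simps split: bool.split)

lemma half_simps:
  "half 0 = Some 0" "half (numeral (num.Bit0 k)) = Some (numeral k)"
  "half (- numeral (num.Bit0 k)) = Some (- numeral k)"
  by (auto simp: half_def)

text \<open>Counters stay in unary, so that \<open>2 \<le> k\<close> is decided by pattern
  matching.\<close>

lemma below_open_simps:
  "below_open P Q r [] = True"
  "below_open P Q r ((d, 0) # ds) = (geq P Q d r \<and> below_open P Q r ds)"
  "below_open P Q r ((d, Suc 0) # ds) = (geq P Q d r \<and> below_open P Q r ds)"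
  "below_open P Q r ((d, Suc (Suc k)) # ds) = below_open P Q r ds"
  by auto

lemma run_simps:
  "run 0 P Q s = s" "run 1 P Q s = step P Q s"
  "run (numeral k) P Q s = run (pred_numeral k) P Q (step P Q s)"
  by (simp_all add: numeral_eq_Suc)

lemma saturated_simps:
  "saturated (Some (n, c, [], [])) = True"
  "saturated (Some (n, c, [], (d, Suc (Suc k)) # ds)) = saturated (Some (n, c, [], ds))"
  by auto

lemma certified_simps:
  "certified p q s B P Q N ds = saturated (run N P Q (advance 3 (B * p, B * s)
     (add_term P Q (B * q, 0) (add_term P Q (B * (3 * p - q), B * (3 * s)) (Some ([], map (\<lambda>d. (d, 0)) ds))))))"
  by (simp add: certified_def start_def advance_def)

lemmas certified_eval =
  certified_simps saturated_simps run_simps step_simps below_open_simps half_simps add_term_simps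
  discard_simps insert_sorted_simps cons_option.simps geq_simps list.map prod.inject
  arith_simps rel_simps pred_numeral_simps arith_special mult_1_left mult_1_right mult_minus1 mult_minus1_right
  minus_minus simp_thms

section \<open>The intervals\<close>

text \<open>In the certificates below, \<open>P / Q\<close> bounds \<open>t\<close> at the far end,
  and \<open>ds\<close> lists the claimed formulas multiplied by \<open>B * q\<close> and rewritten
  in \<open>t\<close>. \<open>N\<close> only has to be large enough, since \<open>step\<close>
  leaves a state without retained terms unchanged.\<close>

lemma certified_right:
  assumes "certified p q 1 B P Q N ds" "0 < q" "0 < B" "0 < Q" "ds \<noteq> []"
    and ab: "1 / 2 \<le> a" "b \<le> 1" "of_int p \<le> of_int q * a" "(of_int q * b - of_int p) * of_int Q \<le> real_of_int P"
    and f: "\<And>x. a \<le> x \<Longrightarrow> x \<le> b \<Longrightarrow>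
      f x = Min (value_at (of_int q * x - of_int p) ` set ds) / (of_int B * of_int q)"
  shows "stabilizes_on {a..b} f"
  unfolding stabilizes_on_def
proof
  fix x assume x: "x \<in> {a..b}"
  have "of_int q * a \<le> of_int q * x" "of_int q * x \<le> of_int q * b"
    using x assms(2) by auto
  moreover from this(2) have "(of_int q * x - of_int p) * of_int Q \<le> (of_int q * b - of_int p) * real_of_int Q"
    using assms(4) by (intro mult_right_mono) auto
  ultimately show "stabilizes (mm_seq x) (f x)"
    using certified_stabilizes[OF assms(1-5), of x] ab f[of x] x by simp
qed

lemma certified_left:
  assumes "certified p q (- 1) B P Q N ds" "0 < q" "0 < B" "0 < Q" "ds \<noteq> []"
    and ab: "1 / 2 \<le> a" "b \<le> 1" "of_int q * b \<le> of_int p" "(of_int p - of_int q * a) * of_int Q \<le> real_of_int P"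
    and f: "\<And>x. a \<le> x \<Longrightarrow> x \<le> b \<Longrightarrow>
      f x = Min (value_at (of_int p - of_int q * x) ` set ds) / (of_int B * of_int q)"
  shows "stabilizes_on {a..b} f"
  unfolding stabilizes_on_def
proof
  fix x assume x: "x \<in> {a..b}"
  have "of_int q * a \<le> of_int q * x" "of_int q * x \<le> of_int q * b"
    using x assms(2) by auto
  moreover from this(1) have "(of_int p - of_int q * x) * of_int Q \<le> (of_int p - of_int q * a) * real_of_int Q"
    using assms(4) by (intro mult_right_mono) auto
  ultimately show "stabilizes (mm_seq x) (f x)"
    using certified_stabilizes[OF assms(1-5), of x] ab f[of x] x by simp
qed

section \<open>To the right of \<open>1 / 2\<close>\<close>

lemma near_1_2_right:
  "stabilizes_on {1 / 2 .. 2911001 / 5684610} (\<lambda>x. 333 / 8 * x - 325 / 16)"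
proof (rule certified_right)
  show "certified 1 2 1 128 68696 2842305 132 [(128, 5328)]"
    by (simp only: certified_eval)
qed (simp_all add: value_at_def field_simps)

text \<open>At \<open>339 / 662\<close> two branches of opposite slope meet; such kinks serve as
  base points of their own, with \<open>t\<close> measured from the kink on either side.\<close>

lemma near_339_662_left:
  "stabilizes_on {2911001 / 5684610 .. 339 / 662} (\<lambda>x. - (2840973 / 32) * x + 2909701 / 64)"
proof (rule certified_left)
  show "certified 339 662 (- 1) 128 64 2842305 132 [(84736, 11363892)]"
    by (simp only: certified_eval)
qed (simp_all add: value_at_def field_simps)

text \<open>The range ends at \<open>274 / 535\<close>, where \<open>t = 23 / 535\<close>. The two
  threshold lines meet at \<open>2909629 / 5681930\<close>, so this run yields a formula on each
  side of that point.\<close>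

lemma certified_339_662_right:
  "certified 339 662 1 128 23 535 132 [(84736, 11369188), (84992, 5328)]"
  by (simp only: certified_eval)

lemma near_339_662_right:
  "stabilizes_on {339 / 662 .. 2909629 / 5681930} (\<lambda>x. 2842297 / 32 * x - 2910929 / 64)"
  by (rule certified_right[OF certified_339_662_right]) (simp_all add: value_at_def min_def field_simps)

text \<open>The interval between \<open>2909629 / 5681930\<close> and \<open>90028408624696264845 / 175783207694477729162\<close> is cut
  at \<open>274 / 535\<close> and at distance \<open>t = 1 / 3000\<close> from \<open>120193266020529 / 234681009773714\<close>, since
  no single ordering of the relevant terms is valid on all of it.\<close>

lemma beyond_339_662:
  "stabilizes_on {2909629 / 5681930 .. 274 / 535} (\<lambda>x. 333 / 8 * x - 325 / 16)"
  by (rule certified_right[OF certified_339_662_right]) (simp_all add: value_at_def min_def field_simps)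

lemma beyond_274_535:
  "stabilizes_on {274 / 535 .. 51511399723083857 / 100577575617306000} (\<lambda>x. 333 / 8 * x - 325 / 16)"
proof (rule certified_right)
  show "certified 274 535 1 1024 68626541603899 20115515123461200 90 [(550976, 42624)]"
    by (simp only: certified_eval)
qed (simp_all add: value_at_def field_simps)

text \<open>The second threshold is the line \<open>333 / 8 * x - 325 / 16\<close>, with slope
  \<open>- (333 / 8) * 131072\<close> in \<open>t = p - q * x\<close>. Close to the kink the steep
  line is the smaller one.\<close>

lemma certified_peak_left:
  "certified 120193266020529 234681009773714 (- 1) 131072 1 3000 690 [(30944353920696713216, 703132830777905460776), (30944354248419442688, -5455872)]"
  by (simp only: certified_eval)

lemma before_peak_left:
  "stabilizes_on {51511399723083857 / 100577575617306000 .. 90028408624696264845 / 175783207694477729162} (\<lambda>x. 333 / 8 * x - 325 / 16)"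
  by (rule certified_left[OF certified_peak_left]) (simp_all add: value_at_def min_def field_simps)

lemma peak_left:
  "stabilizes_on {90028408624696264845 / 175783207694477729162 .. 120193266020529 / 234681009773714} (\<lambda>x. - (87891603847238182597 / 16384) * x + 90028408624695599245 / 32768)"
  by (rule certified_left[OF certified_peak_left]) (simp_all add: value_at_def min_def field_simps)

lemma peak_right:
  "stabilizes_on {120193266020529 / 234681009773714 .. 90022305806716382445 / 175771291756643579978} (\<lambda>x. 87885645878322471973 / 16384 * x - 90022305806717048045 / 32768)"
proof (rule certified_right)
  show "certified 120193266020529 234681009773714 1 131072 40965341184 87885645878321789989 690 [(30944353920696713216, 703085167026579775784)]"
    by (simp only: certified_eval)
qed (simp_all add: value_at_def field_simps)

section \<open>Around \<open>2 / 3\<close>\<close>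

lemma near_626_945_left:
  "stabilizes_on {50110610 / 75646209 .. 626 / 945} (\<lambda>x. - (75675009 / 256) * x + 25065033 / 128)"
proof (rule certified_left)
  show "certified 626 945 (- 1) 1024 128 25215403 290 [(1426944, 302700036)]"
    by (simp only: certified_eval)
qed (simp_all add: value_at_def field_simps)

text \<open>The point \<open>2 / 3\<close> corresponds to \<open>t = 4\<close>, so this range
  extends from the kink up to \<open>2 / 3\<close>.\<close>

lemma certified_626_945_right:
  "certified 626 945 1 1024 4 1 290 [(1426944, 302591364), (1428480, -115200)]"
  by (simp only: certified_eval)

lemma near_626_945_right:
  "stabilizes_on {626 / 945 .. 50130770 / 75676641} (\<lambda>x. 75647841 / 256 * x - 25055657 / 128)"
  by (rule certified_right[OF certified_626_945_right]) (simp_all add: value_at_def min_def field_simps)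

lemma near_2_3_left:
  "stabilizes_on {50130770 / 75676641 .. 2 / 3} (\<lambda>x. - (225 / 2) * x + 76)"
  by (rule certified_right[OF certified_626_945_right]) (simp_all add: value_at_def min_def field_simps)

text \<open>The explicit formulas end at \<open>2 / 3\<close>; this piece, with an arbitrarily
  chosen right end, completes a two-sided neighbourhood.\<close>

lemma near_2_3_right:
  "stabilizes_on {2 / 3 .. 2003 / 3000} (\<lambda>x. 231 / 2 * x - 76)"
proof (rule certified_right)
  show "certified 2 3 1 32 3 1000 28 [(96, 3696)]"
    by (simp only: certified_eval)
qed (simp_all add: value_at_def field_simps)

section \<open>The remaining sixteen fractions\<close>

lemma near_3_5_left:
  "stabilizes_on {76675523 / 127792541 .. 3 / 5} (\<lambda>x. - (126466131 / 256) * x + 75880293 / 256)"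
proof (rule certified_left)
  show "certified 3 5 (- 1) 8192 8 127792541 586 [(98304, 4046916192)]"
    by (simp only: certified_eval)
qed (simp_all add: value_at_def field_simps)

lemma near_3_5_right:
  "stabilizes_on {3 / 5 .. 4194392 / 6990653} (\<lambda>x. 126310099 / 256 * x - 75785445 / 256)"
proof (rule certified_right)
  show "certified 3 5 1 8192 1 6990653 586 [(98304, 4041923168)]"
    by (simp only: certified_eval)
qed (simp_all add: value_at_def field_simps)

lemma near_4_7_left:
  "stabilizes_on {1954924 / 3421219 .. 4 / 7} (\<lambda>x. - (200985 / 16) * x + 14359 / 2)"
proof (rule certified_left)
  show "certified 4 7 (- 1) 256 408 3421219 92 [(2624, 3215760)]"
    by (simp only: certified_eval)
qed (simp_all add: value_at_def field_simps)

lemma near_4_7_right: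
  "stabilizes_on {4 / 7 .. 44485228 / 77846827} (\<lambda>x. 202033 / 16 * x - 7214)"
proof (rule certified_right)
  show "certified 4 7 1 256 9288 77846827 99 [(2624, 3232528)]"
    by (simp only: certified_eval)
qed (simp_all add: value_at_def field_simps)

lemma near_5_8_left:
  "stabilizes_on {80040341 / 128065272 .. 5 / 8} (\<lambda>x. - (71307 / 4) * x + 356603 / 32)"
proof (rule certified_left)
  show "certified 5 8 (- 1) 16 454 16008159 111 [(272, 285228)]"
    by (simp only: certified_eval)
qed (simp_all add: value_at_def field_simps)

lemma near_5_8_right:
  "stabilizes_on {5 / 8 .. 149898117 / 239835656} (\<lambda>x. 71307 / 4 * x - 356467 / 32)"
proof (rule certified_right)
  show "certified 5 8 1 16 832 29979457 237 [(272, 285228)]"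
    by (simp only: certified_eval)
qed (simp_all add: value_at_def field_simps)

lemma near_5_9_left:
  "stabilizes_on {24959983 / 44928379 .. 5 / 9} (\<lambda>x. 3 / 16 * (24185 - 43521 * x))"
proof (rule certified_left)
  show "certified 5 9 (- 1) 4096 2048 44928379 127 [(46080, 33424128)]"
    by (simp only: certified_eval)
qed (simp_all add: value_at_def field_simps)

lemma near_5_9_right:
  "stabilizes_on {5 / 9 .. 20203 / 36365} (\<lambda>x. 9 / 16 * (14467 * x - 8035))"
proof (rule certified_right)
  show "certified 5 9 1 4096 2 36365 127 [(46080, 33331968)]"
    by (simp only: certified_eval)
qed (simp_all add: value_at_def field_simps)

lemma near_6_11_left:
  "stabilizes_on {2034476 / 3729873 .. 6 / 11} (\<lambda>x. - (139480363 / 2048) * x + 38041891 / 1024)"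
proof (rule certified_left)
  show "certified 6 11 (- 1) 65536 2 3729873 623 [(1261568, 4463371616)]"
    by (simp only: certified_eval)
qed (simp_all add: value_at_def field_simps)

lemma near_6_11_right:
  "stabilizes_on {6 / 11 .. 2002180 / 3670663} (\<lambda>x. 139446571 / 2048 * x - 38029091 / 1024)"
proof (rule certified_right)
  show "certified 6 11 1 65536 2 3670663 623 [(1261568, 4462290272)]"
    by (simp only: certified_eval)
qed (simp_all add: value_at_def field_simps)

lemma near_7_11_left:
  "stabilizes_on {161123 / 253207 .. 7 / 11} (\<lambda>x. - (49767 / 16) * x + 31691 / 16)"
proof (rule certified_left)
  show "certified 7 11 (- 1) 512 96 253207 126 [(7424, 1592544)]"
    by (simp only: certified_eval)
qed (simp_all add: value_at_def field_simps)

lemma near_7_11_right: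
  "stabilizes_on {7 / 11 .. 1100921 / 1729909} (\<lambda>x. 49695 / 16 * x - 31603 / 16)"
proof (rule certified_right)
  show "certified 7 11 1 512 768 1729909 126 [(7424, 1590240)]"
    by (simp only: certified_eval)
qed (simp_all add: value_at_def field_simps)

lemma near_7_12_left:
  "stabilizes_on {7381379 / 12670284 .. 7 / 12} (\<lambda>x. - 213 * x + 501 / 4)"
proof (rule certified_left)
  show "certified 7 12 (- 1) 16 9620 1055857 31 [(192, 3408)]"
    by (simp only: certified_eval)
qed (simp_all add: value_at_def field_simps)

lemma near_7_12_right:
  "stabilizes_on {7 / 12 .. 52083521 / 89164436} (\<lambda>x. 219 * x - 507 / 4)"
proof (rule certified_right)
  show "certified 7 12 1 16 212800 22291109 49 [(192, 3504)]"
    by (simp only: certified_eval)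
qed (simp_all add: value_at_def field_simps)

lemma near_7_13_left:
  "stabilizes_on {339327836 / 630180267 .. 7 / 13} (\<lambda>x. - (424918635 / 32) * x + 228802391 / 32)"
proof (rule certified_left)
  show "certified 7 13 (- 1) 256 1 630180267 341 [(5104, 3399349080)]"
    by (simp only: certified_eval)
qed (simp_all add: value_at_def field_simps)

lemma near_7_13_right:
  "stabilizes_on {7 / 13 .. 4675837673 / 8683698531} (\<lambda>x. 424847139 / 32 * x - 228763795 / 32)"
proof (rule certified_right)
  show "certified 7 13 1 256 32 8683698531 341 [(5104, 3398777112)]"
    by (simp only: certified_eval)
qed (simp_all add: value_at_def field_simps)

lemma near_8_13_left:
  "stabilizes_on {411836560641067 / 669234411041734 .. 8 / 13} (\<lambda>x. - (9504682471614359 / 1024) * x + 731129420893811 / 128)"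
proof (rule certified_left)
  show "certified 8 13 (- 1) 16384 1 669234411041734 643 [(663552, 152074919545829744)]"
    by (simp only: certified_eval)
qed (simp_all add: value_at_def field_simps)

lemma near_8_13_right:
  "stabilizes_on {8 / 13 .. 1656012165640316 / 2691019769165513} (\<lambda>x. 9504493870368247 / 1024 * x - 731114913104851 / 128)"
proof (rule certified_right)
  show "certified 8 13 1 16384 4 2691019769165513 643 [(663552, 152071901925891952)]"
    by (simp only: certified_eval)
qed (simp_all add: value_at_def field_simps)

lemma near_9_14_left:
  "stabilizes_on {345573 / 537562 .. 9 / 14} (\<lambda>x. - (313309 / 32) * x + 402931 / 64)"
proof (rule certified_left)
  show "certified 9 14 (- 1) 256 18 268781 75 [(5888, 2506472)]"
    by (simp only: certified_eval)
qed (simp_all add: value_at_def field_simps)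

lemma near_9_14_right:
  "stabilizes_on {9 / 14 .. 83961 / 130604} (\<lambda>x. 312701 / 32 * x - 401939 / 64)"
proof (rule certified_right)
  show "certified 9 14 1 256 9 65302 75 [(5888, 2501608)]"
    by (simp only: certified_eval)
qed (simp_all add: value_at_def field_simps)

lemma near_8_15_left:
  "stabilizes_on {15838 / 29697 .. 8 / 15} (\<lambda>x. - (19695 / 8) * x + 1314)"
proof (rule certified_left)
  show "certified 8 15 (- 1) 2048 2 9899 127 [(30720, 5041920)]"
    by (simp only: certified_eval)
qed (simp_all add: value_at_def field_simps)

lemma near_8_15_right:
  "stabilizes_on {8 / 15 .. 27100 / 50811} (\<lambda>x. 19815 / 8 * x - 1320)"
proof (rule certified_right)
  show "certified 8 15 1 2048 4 16937 127 [(30720, 5072640)]"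
    by (simp only: certified_eval)
qed (simp_all add: value_at_def field_simps)

lemma near_9_16_left:
  "stabilizes_on {599428 / 1066971 .. 9 / 16} (\<lambda>x. - 486 * x + 2195 / 8)"
proof (rule certified_left)
  show "certified 9 16 (- 1) 8 11891 1066971 53 [(128, 3888)]"
    by (simp only: certified_eval)
qed (simp_all add: value_at_def field_simps)

lemma near_9_16_right:
  "stabilizes_on {9 / 16 .. 340224257 / 604065151} (\<lambda>x. 494 * x - 2215 / 8)"
proof (rule certified_right)
  show "certified 9 16 1 32 7001753 604065151 98 [(512, 15808)]"
    by (simp only: certified_eval)
qed (simp_all add: value_at_def field_simps)

lemma near_9_17_left:
  "stabilizes_on {50463303 / 95323759 .. 9 / 17} (\<lambda>x. - (151759 / 32) * x + 80375 / 32)"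
proof (rule certified_left)
  show "certified 9 17 (- 1) 512 37680 95323759 77 [(8704, 2428144)]"
    by (simp only: certified_eval)
qed (simp_all add: value_at_def field_simps)

lemma near_9_17_right:
  "stabilizes_on {9 / 17 .. 82731 / 156263} (\<lambda>x. 152303 / 32 * x - 80599 / 32)"
proof (rule certified_right)
  show "certified 9 17 1 256 60 156263 75 [(4352, 1218424)]"
    by (simp only: certified_eval)
qed (simp_all add: value_at_def field_simps)

lemma near_10_17_left:
  "stabilizes_on {40009991 / 68016985 .. 10 / 17} (\<lambda>x. - (11203293 / 2) * x + 3295088)"
proof (rule certified_left)
  show "certified 10 17 (- 1) 64 3 68016985 112 [(1984, 358505376)]"
    by (simp only: certified_eval)
qed (simp_all add: value_at_def field_simps)

lemma near_10_17_right:
  "stabilizes_on {10 / 17 .. 8901073 / 15131824} (\<lambda>x. 11211513 / 2 * x - 3297502)"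
proof (rule certified_right)
  show "certified 10 17 1 64 1 15131824 112 [(1984, 358768416)]"
    by (simp only: certified_eval)
qed (simp_all add: value_at_def field_simps)

lemma near_11_17_left:
  "stabilizes_on {193668583 / 299305992 .. 11 / 17} (\<lambda>x. - (11184345087 / 1024) * x + 7236931237 / 1024)"
proof (rule certified_left)
  show "certified 11 17 (- 1) 32768 1 299305992 623 [(1122304, 357899042784)]"
    by (simp only: certified_eval)
qed (simp_all add: value_at_def field_simps)

lemma near_11_17_right:
  "stabilizes_on {11 / 17 .. 190590017 / 294548208} (\<lambda>x. 11198078463 / 1024 * x - 7245813413 / 1024)"
proof (rule certified_right)
  show "certified 11 17 1 32768 1 294548208 623 [(1122304, 358338510816)]"
    by (simp only: certified_eval)
qed (simp_all add: value_at_def field_simps)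

lemma near_11_18_left:
  "stabilizes_on {362832747 / 593726330 .. 11 / 18} (\<lambda>x. - (361818645 / 128) * x + 442223279 / 256)"
proof (rule certified_left)
  show "certified 11 18 (- 1) 1024 92 296863165 293 [(35328, 2894549160)]"
    by (simp only: certified_eval)
qed (simp_all add: value_at_def field_simps)

lemma near_11_18_right:
  "stabilizes_on {11 / 18 .. 71738975 / 117391047} (\<lambda>x. 361521237 / 128 * x - 441858799 / 256)"
proof (rule certified_right)
  show "certified 11 18 1 1024 11 39130349 293 [(35328, 2892169896)]"
    by (simp only: certified_eval)
qed (simp_all add: value_at_def field_simps)

section \<open>The neighbourhoods\<close>

lemma between_peaks:
  "stabilizes_on {2909629 / 5681930 .. 90028408624696264845 / 175783207694477729162}
     (\<lambda>x. 333 / 8 * x - 325 / 16)"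
  by (rule stabilizes_on_cong[OF stabilizes_on_Un[OF stabilizes_on_Un[OF beyond_339_662 beyond_274_535]
        before_peak_left]]) auto

definition good_neighbourhood :: "real \<Rightarrow> bool" where
  "good_neighbourhood c \<longleftrightarrow> (\<exists>U. open U \<and> c \<in> U \<and> U \<subseteq> {0<..<1} \<and>
     (\<forall>x\<in>U. mm_length x < \<infinity>) \<and> continuous_on U mm_map)"

lemma good_neighbourhoods:
  "\<forall>c\<in>{1/2, 2/3, 3/5, 4/7, 5/8, 5/9, 6/11, 7/11, 7/12, 7/13, 8/13, 9/14, 8/15, 9/16, 9/17, 10/17, 11/17, 11/18}.
     good_neighbourhood c"
proof -
  note good = continuous_neighbourhood[folded good_neighbourhood_def]
  \<comment> \<open>The left end is \<open>1 - 2911001 / 5684610\<close>.\<close>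
  have half: "stabilizes_on {2773609 / 5684610..1 / 2} (\<lambda>x. 1 - (333 / 8 * (1 - x) - 325 / 16))"
    using stabilizes_on_reflect[OF near_1_2_right] by simp
  have "good_neighbourhood (1 / 2)"
    by (rule good[OF half near_1_2_right]) (auto intro!: continuous_intros)
  moreover have "good_neighbourhood (2 / 3)"
    by (rule good[OF near_2_3_left near_2_3_right]) (auto intro!: continuous_intros)
  moreover have "good_neighbourhood (3 / 5)"
    by (rule good[OF near_3_5_left near_3_5_right]) (auto intro!: continuous_intros)
  moreover have "good_neighbourhood (4 / 7)"
    by (rule good[OF near_4_7_left near_4_7_right]) (auto intro!: continuous_intros)
  moreover have "good_neighbourhood (5 / 8)"
    by (rule good[OF near_5_8_left near_5_8_right]) (auto intro!: continuous_intros)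
  moreover have "good_neighbourhood (5 / 9)"
    by (rule good[OF near_5_9_left near_5_9_right]) (auto intro!: continuous_intros)
  moreover have "good_neighbourhood (6 / 11)"
    by (rule good[OF near_6_11_left near_6_11_right]) (auto intro!: continuous_intros)
  moreover have "good_neighbourhood (7 / 11)"
    by (rule good[OF near_7_11_left near_7_11_right]) (auto intro!: continuous_intros)
  moreover have "good_neighbourhood (7 / 12)"
    by (rule good[OF near_7_12_left near_7_12_right]) (auto intro!: continuous_intros)
  moreover have "good_neighbourhood (7 / 13)"
    by (rule good[OF near_7_13_left near_7_13_right]) (auto intro!: continuous_intros)
  moreover have "good_neighbourhood (8 / 13)"
    by (rule good[OF near_8_13_left near_8_13_right]) (auto intro!: continuous_intros)
  moreover have "good_neighbourhood (9 / 14)"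
    by (rule good[OF near_9_14_left near_9_14_right]) (auto intro!: continuous_intros)
  moreover have "good_neighbourhood (8 / 15)"
    by (rule good[OF near_8_15_left near_8_15_right]) (auto intro!: continuous_intros)
  moreover have "good_neighbourhood (9 / 16)"
    by (rule good[OF near_9_16_left near_9_16_right]) (auto intro!: continuous_intros)
  moreover have "good_neighbourhood (9 / 17)"
    by (rule good[OF near_9_17_left near_9_17_right]) (auto intro!: continuous_intros)
  moreover have "good_neighbourhood (10 / 17)"
    by (rule good[OF near_10_17_left near_10_17_right]) (auto intro!: continuous_intros)
  moreover have "good_neighbourhood (11 / 17)"
    by (rule good[OF near_11_17_left near_11_17_right]) (auto intro!: continuous_intros)
  moreover have "good_neighbourhood (11 / 18)"
    by (rule good[OF near_11_18_left near_11_18_right]) (auto intro!: continuous_intros)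
  ultimately show ?thesis by simp
qed

lemma fraction_cases:
  fixes p q :: int
  assumes "2 \<le> q" "q \<le> 18" "q \<le> 2 * p" "3 * p \<le> 2 * q"
  shows "real_of_int p / real_of_int q \<in>
    {1/2, 2/3, 3/5, 4/7, 5/8, 5/9, 6/11, 7/11, 7/12, 7/13, 8/13, 9/14, 8/15, 9/16, 9/17, 10/17, 11/17, 11/18}"
proof -
  define F :: "(int \<times> int) list" where "F = [(1, 2), (2, 3), (3, 5), (4, 7), (5, 8), (5, 9), (6, 11), (7, 11), (7, 12), (7, 13),
    (8, 13), (9, 14), (8, 15), (9, 16), (9, 17), (10, 17), (11, 17), (11, 18)]"
  \<comment> \<open>From \<open>3 * p \<le> 2 * q \<le> 36\<close> follows
    \<open>p \<le> 12\<close>. Cross multiplication also covers fractions that are not in lowest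
    terms.\<close>
  have "\<forall>q\<in>set [2..18]. \<forall>p\<in>set [1..12]. q \<le> 2 * p \<longrightarrow> 3 * p \<le> 2 * q \<longrightarrow> (\<exists>(a, b)\<in>set F. p * b = a * q)"
    by (simp add: F_def upto.simps)
  moreover have "q \<in> set [2..18]" "p \<in> set [1..12]" unfolding set_upto using assms by auto
  ultimately obtain a b where ab: "(a, b) \<in> set F" "p * b = a * q" using assms(3,4) by blast
  have "real_of_int p * of_int b = of_int a * of_int q" using ab(2) by (metis of_int_mult)
  moreover have "b \<noteq> 0" using ab(1) by (auto simp: F_def)
  ultimately have "real_of_int p / of_int q = of_int a / of_int b" using assms(1) by (simp add: frac_eq_eq)
  thus ?thesis using ab(1) by (auto simp: F_def)
qed

theorem theorem1p3:
  shows "(\<forall>(p::int) (q::int). 2 \<le> q \<and> q \<le> 18 \<and> real_of_int p / real_of_int q \<in> {1 / 2 .. 2 / 3} \<longrightarrow>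
      (\<exists>U. open U \<and> real_of_int p / real_of_int q \<in> U \<and> U \<subseteq> {0<..<1} \<and>
           (\<forall>x\<in>U. mm_length x < \<infinity>) \<and> continuous_on U mm_map))
    \<and> mm_map_given_on {1 / 2 .. 2911001 / 5684610}
        (\<lambda>x. 333 / 8 * x - 325 / 16)
    \<and> mm_map_given_on {2911001 / 5684610 .. 339 / 662}
        (\<lambda>x. - (2840973 / 32) * x + 2909701 / 64)
    \<and> mm_map_given_on {339 / 662 .. 2909629 / 5681930}
        (\<lambda>x. 2842297 / 32 * x - 2910929 / 64)
    \<and> mm_map_given_on {2909629 / 5681930 .. 90028408624696264845 / 175783207694477729162}
        (\<lambda>x. 333 / 8 * x - 325 / 16)
    \<and> mm_map_given_on {90028408624696264845 / 175783207694477729162 .. 120193266020529 / 234681009773714}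
        (\<lambda>x. - (87891603847238182597 / 16384) * x + 90028408624695599245 / 32768)
    \<and> mm_map_given_on {120193266020529 / 234681009773714 .. 90022305806716382445 / 175771291756643579978}
        (\<lambda>x. 87885645878322471973 / 16384 * x - 90022305806717048045 / 32768)
    \<and> mm_map_given_on {50110610 / 75646209 .. 626 / 945}
        (\<lambda>x. - (75675009 / 256) * x + 25065033 / 128)
    \<and> mm_map_given_on {626 / 945 .. 50130770 / 75676641}
        (\<lambda>x. 75647841 / 256 * x - 25055657 / 128)
    \<and> mm_map_given_on {50130770 / 75676641 .. 2 / 3}
        (\<lambda>x. - (225 / 2) * x + 76)
    \<and> mm_map_given_on {76675523 / 127792541 .. 3 / 5}
        (\<lambda>x. - (126466131 / 256) * x + 75880293 / 256)
    \<and> mm_map_given_on {3 / 5 .. 4194392 / 6990653}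
        (\<lambda>x. 126310099 / 256 * x - 75785445 / 256)
    \<and> mm_map_given_on {1954924 / 3421219 .. 4 / 7}
        (\<lambda>x. - (200985 / 16) * x + 14359 / 2)
    \<and> mm_map_given_on {4 / 7 .. 44485228 / 77846827}
        (\<lambda>x. 202033 / 16 * x - 7214)
    \<and> mm_map_given_on {80040341 / 128065272 .. 5 / 8}
        (\<lambda>x. - (71307 / 4) * x + 356603 / 32)
    \<and> mm_map_given_on {5 / 8 .. 149898117 / 239835656}
        (\<lambda>x. 71307 / 4 * x - 356467 / 32)
    \<and> mm_map_given_on {24959983 / 44928379 .. 5 / 9}
        (\<lambda>x. 3 / 16 * (24185 - 43521 * x))
    \<and> mm_map_given_on {5 / 9 .. 20203 / 36365}
        (\<lambda>x. 9 / 16 * (14467 * x - 8035))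
    \<and> mm_map_given_on {2034476 / 3729873 .. 6 / 11}
        (\<lambda>x. - (139480363 / 2048) * x + 38041891 / 1024)
    \<and> mm_map_given_on {6 / 11 .. 2002180 / 3670663}
        (\<lambda>x. 139446571 / 2048 * x - 38029091 / 1024)
    \<and> mm_map_given_on {161123 / 253207 .. 7 / 11}
        (\<lambda>x. - (49767 / 16) * x + 31691 / 16)
    \<and> mm_map_given_on {7 / 11 .. 1100921 / 1729909}
        (\<lambda>x. 49695 / 16 * x - 31603 / 16)
    \<and> mm_map_given_on {7381379 / 12670284 .. 7 / 12}
        (\<lambda>x. - 213 * x + 501 / 4)
    \<and> mm_map_given_on {7 / 12 .. 52083521 / 89164436}
        (\<lambda>x. 219 * x - 507 / 4)
    \<and> mm_map_given_on {339327836 / 630180267 .. 7 / 13}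
        (\<lambda>x. - (424918635 / 32) * x + 228802391 / 32)
    \<and> mm_map_given_on {7 / 13 .. 4675837673 / 8683698531}
        (\<lambda>x. 424847139 / 32 * x - 228763795 / 32)
    \<and> mm_map_given_on {411836560641067 / 669234411041734 .. 8 / 13}
        (\<lambda>x. - (9504682471614359 / 1024) * x + 731129420893811 / 128)
    \<and> mm_map_given_on {8 / 13 .. 1656012165640316 / 2691019769165513}
        (\<lambda>x. 9504493870368247 / 1024 * x - 731114913104851 / 128)
    \<and> mm_map_given_on {345573 / 537562 .. 9 / 14}
        (\<lambda>x. - (313309 / 32) * x + 402931 / 64)
    \<and> mm_map_given_on {9 / 14 .. 83961 / 130604}
        (\<lambda>x. 312701 / 32 * x - 401939 / 64)
    \<and> mm_map_given_on {15838 / 29697 .. 8 / 15}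
        (\<lambda>x. - (19695 / 8) * x + 1314)
    \<and> mm_map_given_on {8 / 15 .. 27100 / 50811}
        (\<lambda>x. 19815 / 8 * x - 1320)
    \<and> mm_map_given_on {599428 / 1066971 .. 9 / 16}
        (\<lambda>x. - 486 * x + 2195 / 8)
    \<and> mm_map_given_on {9 / 16 .. 340224257 / 604065151}
        (\<lambda>x. 494 * x - 2215 / 8)
    \<and> mm_map_given_on {50463303 / 95323759 .. 9 / 17}
        (\<lambda>x. - (151759 / 32) * x + 80375 / 32)
    \<and> mm_map_given_on {9 / 17 .. 82731 / 156263}
        (\<lambda>x. 152303 / 32 * x - 80599 / 32)
    \<and> mm_map_given_on {40009991 / 68016985 .. 10 / 17}
        (\<lambda>x. - (11203293 / 2) * x + 3295088)
    \<and> mm_map_given_on {10 / 17 .. 8901073 / 15131824}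
        (\<lambda>x. 11211513 / 2 * x - 3297502)
    \<and> mm_map_given_on {193668583 / 299305992 .. 11 / 17}
        (\<lambda>x. - (11184345087 / 1024) * x + 7236931237 / 1024)
    \<and> mm_map_given_on {11 / 17 .. 190590017 / 294548208}
        (\<lambda>x. 11198078463 / 1024 * x - 7245813413 / 1024)
    \<and> mm_map_given_on {362832747 / 593726330 .. 11 / 18}
        (\<lambda>x. - (361818645 / 128) * x + 442223279 / 256)
    \<and> mm_map_given_on {11 / 18 .. 71738975 / 117391047}
        (\<lambda>x. 361521237 / 128 * x - 441858799 / 256)"
proof -
  have "\<exists>U. open U \<and> real_of_int p / real_of_int q \<in> U \<and> U \<subseteq> {0<..<1} \<and>
      (\<forall>x\<in>U. mm_length x < \<infinity>) \<and> continuous_on U mm_map"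
    if "2 \<le> q \<and> q \<le> 18 \<and> real_of_int p / real_of_int q \<in> {1 / 2 .. 2 / 3}" for p q :: int
  proof -
    have "real_of_int q \<le> 2 * of_int p" "3 * real_of_int p \<le> 2 * of_int q"
      using that by (auto simp: field_simps)
    hence "q \<le> 2 * p" "3 * p \<le> 2 * q" by linarith+
    with that have "good_neighbourhood (real_of_int p / real_of_int q)"
      using fraction_cases good_neighbourhoods by blast
    thus ?thesis unfolding good_neighbourhood_def .
  qed
  thus ?thesis
    by (intro conjI allI impI) (blast | rule stabilizes_on_imp_given,
      rule near_1_2_right near_339_662_left near_339_662_right between_peaks
        peak_left peak_right near_626_945_left near_626_945_right
        near_2_3_left near_3_5_left near_3_5_right near_4_7_left
        near_4_7_right near_5_8_left near_5_8_right near_5_9_left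
        near_5_9_right near_6_11_left near_6_11_right near_7_11_left
        near_7_11_right near_7_12_left near_7_12_right near_7_13_left
        near_7_13_right near_8_13_left near_8_13_right near_9_14_left
        near_9_14_right near_8_15_left near_8_15_right near_9_16_left
        near_9_16_right near_9_17_left near_9_17_right near_10_17_left
        near_10_17_right near_11_17_left near_11_17_right near_11_18_left
        near_11_18_right)+
qed

end
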